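(* Let $\alpha,\lambda\in\mathbb{R}$ with $\alpha\lambda\neq0$. Then $T^*_{\mathrm{reg}}\mathbb{R}^5=T^*\mathbb{R}^5\setminus\mathcal{J}^{-1}(0)$, with the action $\Psi$ of $GL(2,\mathbb{R})$ and the projection $$\pi:T^*_{\mathrm{reg}}\mathbb{R}^5\to G(2,5),\qquad \pi(q,p)=\mathrm{span}\{q,\eta_{\lambda,\alpha}^{-1}p\},$$ is the total space of a $GL(2,\mathbb{R})$-principal bundle over the Grassmannian $G(2,5)$ of $2$-dimensional vector subspaces of $\mathbb{R}^5$.
   Context: $T^*\mathbb{R}^5\cong\mathbb{R}^5\times\mathbb{R}^{5*}$ with elements $(q,p)$ written as column vectors, and $\eta_{\lambda,\alpha}=\mathrm{diag}(\alpha\lambda,\lambda,1,1,1)$. The map $\mathcal{J}:T^*\mathbb{R}^5\to\mathfrak{so}(5)$ (antisymmetric real $5\times5$ matrices) is $$\mathcal{J}(q,p)=q(\eta_{\lambda,\alpha}^{-1}p)^\top-(\eta_{\lambda,\alpha}^{-1}p)q^\top.$$ $T^*_{\mathrm{reg}}\mathbb{R}^5$ is the set of $(q,p)$ such that $q$ and $\eta_{\lambda,\alpha}^{-1}p$ are linearly independent in $\mathbb{R}^5$; it equals $T^*\mathbb{R}^5\setminus\mathcal{J}^{-1}(0)$. For $A=\begin{pmatrix}a&b\\c&d\end{pmatrix}\in GL(2,\mathbb{R})$, $$\Psi_A(q,p)=\big(aq+b\,\eta_{\lambda,\alpha}^{-1}p,\;c\,\eta_{\lambda,\alpha}q+d\,p\big).$$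 Principal bundle is understood for the (left) action $\Psi$. *)

theory Defs
  imports "HOL-Analysis.Analysis" "HOL-Algebra.Group_Action"
begin

section \<open>Smooth maps between open subsets of Euclidean spaces\<close>

text \<open>Intended for open \<open>S\<close> only. All iterated directional derivatives exist up to the
  given order and are differentiable, the last ones being continuous.\<close>

primrec Ck_on :: "nat \<Rightarrow> 'a::euclidean_space set \<Rightarrow> ('a \<Rightarrow> 'b::euclidean_space) \<Rightarrow> bool"
  where
    "Ck_on 0 S f \<longleftrightarrow> continuous_on S f"
  | "Ck_on (Suc k) S f \<longleftrightarrow>
       (\<forall>x\<in>S. f differentiable (at x)) \<and>
       (\<forall>v. Ck_on k S (\<lambda>x. frechet_derivative f (at x) v))"

definition smooth_on :: "'a::euclidean_space set \<Rightarrow> ('a \<Rightarrow> 'b::euclidean_space) \<Rightarrow> bool"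
  where "smooth_on S f \<longleftrightarrow> (\<forall>k. Ck_on k S f)"


section \<open>Smooth manifolds\<close>

text \<open>A chart is a pair of its domain and its coordinate map; the values of the coordinate map
  outside the domain are irrelevant. The smooth structure is given by a (not necessarily maximal)
  atlas.\<close>

record ('a, 'e) manifold =
  mtop :: "'a topology"
  charts :: "('a set \<times> ('a \<Rightarrow> 'e)) set"

abbreviation points :: "('a, 'e) manifold \<Rightarrow> 'a set"
  where "points M \<equiv> topspace (mtop M)"

definition smooth_manifold :: "('a, 'e::euclidean_space) manifold \<Rightarrow> bool"
  where "smooth_manifold M \<longleftrightarrow>
    Hausdorff_space (mtop M) \<and> second_countable (mtop M) \<and>
    (\<Union>(U, \<phi>)\<in>charts M. U) = points M \<and>
    (\<forall>(U, \<phi>)\<in>charts M. openin (mtop M) U \<and> open (\<phi> ` U) \<and>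
       homeomorphic_map (subtopology (mtop M) U) (top_of_set (\<phi> ` U)) \<phi>) \<and>
    (\<forall>(U, \<phi>)\<in>charts M. \<forall>(V, \<psi>)\<in>charts M.
       smooth_on (\<phi> ` (U \<inter> V)) (\<psi> \<circ> inv_into U \<phi>))"

definition smooth_map ::
    "('a, 'e::euclidean_space) manifold \<Rightarrow> ('b, 'f::euclidean_space) manifold \<Rightarrow> ('a \<Rightarrow> 'b) \<Rightarrow> bool"
  where "smooth_map M N f \<longleftrightarrow>
    continuous_map (mtop M) (mtop N) f \<and>
    (\<forall>(U, \<phi>)\<in>charts M. \<forall>(V, \<psi>)\<in>charts N.
       smooth_on (\<phi> ` (U \<inter> f -` V)) (\<psi> \<circ> f \<circ> inv_into U \<phi>))"

definition diffeomorphism ::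
    "('a, 'e::euclidean_space) manifold \<Rightarrow> ('b, 'f::euclidean_space) manifold \<Rightarrow> ('a \<Rightarrow> 'b) \<Rightarrow> bool"
  where "diffeomorphism M N f \<longleftrightarrow>
    bij_betw f (points M) (points N) \<and> smooth_map M N f \<and>
    smooth_map N M (inv_into (points M) f)"

definition open_submanifold :: "('a, 'e) manifold \<Rightarrow> 'a set \<Rightarrow> ('a, 'e) manifold"
  where "open_submanifold M S =
    \<lparr>mtop = subtopology (mtop M) S, charts = (\<lambda>(U, \<phi>). (U \<inter> S, \<phi>)) ` charts M\<rparr>"

definition prod_manifold ::
    "('a, 'e) manifold \<Rightarrow> ('b, 'f) manifold \<Rightarrow> ('a \<times> 'b, 'e \<times> 'f) manifold"
  where "prod_manifold M N =
    \<lparr>mtop = prod_topology (mtop M) (mtop N),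
     charts = {(U \<times> V, map_prod \<phi> \<psi>) | U \<phi> V \<psi>. (U, \<phi>) \<in> charts M \<and> (V, \<psi>) \<in> charts N}\<rparr>"

definition euclidean_open :: "'e::euclidean_space set \<Rightarrow> ('e, 'e) manifold"
  where "euclidean_open S = \<lparr>mtop = top_of_set S, charts = {(S, id)}\<rparr>"


section \<open>Lie groups and principal bundles\<close>

definition lie_group :: "'g monoid \<Rightarrow> ('g, 'e::euclidean_space) manifold \<Rightarrow> bool"
  where "lie_group G GM \<longleftrightarrow>
    group G \<and> smooth_manifold GM \<and> carrier G = points GM \<and>
    smooth_map (prod_manifold GM GM) GM (\<lambda>(g, h). g \<otimes>\<^bsub>G\<^esub> h) \<and>
    smooth_map GM GM (\<lambda>g. inv\<^bsub>G\<^esub> g)"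

text \<open>The restriction in the first conjunct only serves to meet the extensionality
  convention of \<^const>\<open>BijGroup\<close>.\<close>

definition smooth_action ::
    "'g monoid \<Rightarrow> ('g, 'e::euclidean_space) manifold \<Rightarrow> ('p, 'f::euclidean_space) manifold
      \<Rightarrow> ('g \<Rightarrow> 'p \<Rightarrow> 'p) \<Rightarrow> bool"
  where "smooth_action G GM P act \<longleftrightarrow>
    group_action G (points P) (\<lambda>g. restrict (act g) (points P)) \<and>
    smooth_map (prod_manifold GM P) P (\<lambda>(g, p). act g p)"

text \<open>Smooth principal bundle for a left action: around every point of the base there is a
  trivialization over the base which is equivariant for left translation on the group factor.
  Surjectivity of the projection, freeness of the action and the fact that the fibres are
  exactly the orbits are consequences.\<close>

definition principal_bundle ::
    "'g monoid \<Rightarrow> ('g, 'e::euclidean_space) manifold \<Rightarrow> ('p, 'f::euclidean_space) manifold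
      \<Rightarrow> ('b, 'h::euclidean_space) manifold \<Rightarrow> ('g \<Rightarrow> 'p \<Rightarrow> 'p) \<Rightarrow> ('p \<Rightarrow> 'b) \<Rightarrow> bool"
  where "principal_bundle G GM P B act \<pi> \<longleftrightarrow>
    lie_group G GM \<and> smooth_manifold P \<and> smooth_manifold B \<and>
    smooth_action G GM P act \<and> smooth_map P B \<pi> \<and>
    (\<forall>b\<in>points B. \<exists>U \<Phi>. openin (mtop B) U \<and> b \<in> U \<and>
       diffeomorphism (open_submanifold P {p \<in> points P. \<pi> p \<in> U})
         (prod_manifold (open_submanifold B U) GM) \<Phi> \<and>
       (\<forall>p\<in>points P. \<pi> p \<in> U \<longrightarrow>
          fst (\<Phi> p) = \<pi> p \<and>
          (\<forall>g\<in>carrier G. \<Phi> (act g p) = (\<pi> p, g \<otimes>\<^bsub>G\<^esub> snd (\<Phi> p)))))"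


section \<open>The Lie group $GL(2,R)$\<close>

definition GL2 :: "(real^2^2) monoid"
  where "GL2 = \<lparr>carrier = {A. invertible A}, mult = (**), one = mat 1\<rparr>"

definition GL2_manifold :: "(real^2^2, real^2^2) manifold"
  where "GL2_manifold = euclidean_open {A. invertible A}"


section \<open>The Grassmannian $G(2,5)$\<close>

definition Gr25 :: "(real^5) set set"
  where "Gr25 = {W. subspace W \<and> dim W = 2}"

text \<open>Full-rank $5 \times 2$ matrices, i.e. bases of 2-dimensional subspaces; the Grassmannian
  carries the quotient topology under the column space map.\<close>

definition frames25 :: "(real^2^5) set"
  where "frames25 = {F. inj ((*v) F)}"

definition Gr25_topology :: "(real^5) set topology"
  where "Gr25_topology =
    topology (\<lambda>U. U \<subseteq> Gr25 \<and> openin (top_of_set frames25) {F \<in> frames25. range ((*v) F) \<in> U})"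

lemma openin_Gr25_topology:
  "openin Gr25_topology U \<longleftrightarrow>
     U \<subseteq> Gr25 \<and> openin (top_of_set frames25) {F \<in> frames25. range ((*v) F) \<in> U}"
proof -
  let ?L = "\<lambda>U. {F \<in> frames25. range ((*v) F) \<in> U}"
  have inter: "?L (S \<inter> T) = ?L S \<inter> ?L T" for S T by auto
  have union: "?L (\<Union>K) = \<Union>(?L ` K)" for K by auto
  have "istopology (\<lambda>U. U \<subseteq> Gr25 \<and> openin (top_of_set frames25) (?L U))"
    unfolding istopology_def inter union by (intro conjI allI impI openin_Int openin_Union) auto
  then show ?thesis
    by (simp add: Gr25_topology_def)
qed

lemma topspace_Gr25_topology: "topspace Gr25_topology = Gr25"
proof -
  have "range ((*v) F) \<in> Gr25" if "F \<in> frames25" for F :: "real^2^5"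
  proof -
    have lin: "linear ((*v) F)" by simp
    have "dim (range ((*v) F)) = dim (UNIV :: (real^2) set)"
      using that by (intro dim_image_eq[OF lin]) (auto simp: frames25_def)
    moreover have "subspace (range ((*v) F))"
      using lin by (simp add: linear_subspace_image)
    ultimately show ?thesis by (simp add: Gr25_def)
  qed
  then have "{F \<in> frames25. range ((*v) F) \<in> Gr25} = frames25" by auto
  then have "openin Gr25_topology Gr25" by (simp add: openin_Gr25_topology)
  then show ?thesis
    by (metis openin_Gr25_topology openin_subset openin_topspace subset_antisym)
qed

text \<open>Standard graph charts: for each splitting of the ambient space into
  \<open>range E \<oplus> range F\<close>, a plane transverse to \<open>range F\<close> is the graph of a unique linear map
  from the first summand to the second, with matrix \<open>M\<close>.\<close>

definition Gr25_chart_domain :: "real^3^5 \<Rightarrow> (real^5) set set"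
  where "Gr25_chart_domain F = {W \<in> Gr25. W \<inter> range ((*v) F) = {0}}"

definition Gr25_chart :: "real^2^5 \<Rightarrow> real^3^5 \<Rightarrow> (real^5) set \<Rightarrow> real^2^3"
  where "Gr25_chart E F W = (THE M. W = range ((*v) (E + F ** M)))"

definition Gr25_manifold :: "((real^5) set, real^2^3) manifold"
  where "Gr25_manifold =
    \<lparr>mtop = Gr25_topology,
     charts = {(Gr25_chart_domain F, Gr25_chart E F) | E F. bij (\<lambda>(x, y). E *v x + F *v y)}\<rparr>"


section \<open>The cotangent bundle of $R^5$\<close>

text \<open>Elements \<open>(q, p)\<close>, both written as column vectors. The first two indices of the type
  \<^typ>\<open>5\<close> are 1 and 2; the index 5 is the element 0.\<close>

definition \<eta> :: "real \<Rightarrow> real \<Rightarrow> real^5^5"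
  where "\<eta> lam \<alpha> =
    (\<chi> i j. if i = j then (if i = 1 then \<alpha> * lam else if i = 2 then lam else 1) else 0)"

definition momentum_J :: "real \<Rightarrow> real \<Rightarrow> (real^5) \<times> (real^5) \<Rightarrow> real^5^5"
  where "momentum_J lam \<alpha> = (\<lambda>(q, p).
    let r = matrix_inv (\<eta> lam \<alpha>) *v p in
      (columnvector q :: real^1^5) ** (rowvector r :: real^5^1)
      - (columnvector r :: real^1^5) ** (rowvector q :: real^5^1))"

lemma momentum_J_antisymmetric:
  "transpose (momentum_J lam \<alpha> z) = - momentum_J lam \<alpha> z"
  by (cases z) (simp add: momentum_J_def Let_def transpose_def columnvector_def rowvector_def
      matrix_matrix_mult_def vec_eq_iff mult.commute)

text \<open>The condition \<open>q \<noteq> r\<close> is needed because \<^const>\<open>independent\<close> refers to the set \<open>{q, r}\<close>.\<close>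

definition Treg :: "real \<Rightarrow> real \<Rightarrow> ((real^5) \<times> (real^5)) set"
  where "Treg lam \<alpha> =
    {(q, p). q \<noteq> matrix_inv (\<eta> lam \<alpha>) *v p \<and> independent {q, matrix_inv (\<eta> lam \<alpha>) *v p}}"

definition \<Psi> :: "real \<Rightarrow> real \<Rightarrow> real^2^2 \<Rightarrow> (real^5) \<times> (real^5) \<Rightarrow> (real^5) \<times> (real^5)"
  where "\<Psi> lam \<alpha> A = (\<lambda>(q, p).
    (A$1$1 *\<^sub>R q + A$1$2 *\<^sub>R (matrix_inv (\<eta> lam \<alpha>) *v p),
     A$2$1 *\<^sub>R (\<eta> lam \<alpha> *v q) + A$2$2 *\<^sub>R p))"

definition proj_span :: "real \<Rightarrow> real \<Rightarrow> (real^5) \<times> (real^5) \<Rightarrow> (real^5) set"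
  where "proj_span lam \<alpha> = (\<lambda>(q, p). span {q, matrix_inv (\<eta> lam \<alpha>) *v p})"

end

theory Submission
  imports Defs
begin

text \<open>
  Write a point \<open>(q, p)\<close> as the full-rank \<open>5 \<times> 2\<close> matrix \<open>X\<close> with columns \<open>q\<close> and
  \<open>r = \<eta>\<inverse> p\<close>. Then \<open>\<pi>\<close> is the column space, and \<open>\<Psi>\<close> acts by \<open>X \<mapsto> X A\<^sup>T\<close>. A splitting of the
  ambient space into the column spaces of \<open>E\<close> and \<open>F\<close> has coordinate projections \<open>P\<close>, \<open>Q\<close> with
  \<open>E P + F Q = 1\<close>; the column space of \<open>X\<close> is transverse to that of \<open>F\<close> iff \<open>P X\<close> is invertible,
  its graph coordinate is \<open>Q X (P X)\<inverse>\<close>, and \<open>(q, p) \<mapsto> (\<pi>(q, p), (P X)\<^sup>T)\<close> is an equivariant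
  trivialization over this chart domain. All coordinate expressions are rational functions, hence
  smooth. Finally \<open>\<J>(q, p) = 0\<close> says that all \<open>2 \<times> 2\<close> minors of \<open>X\<close> vanish.
\<close>

section \<open>Smooth calculus with matrices\<close>

lemma Ck_on_subset: "Ck_on k T f \<Longrightarrow> S \<subseteq> T \<Longrightarrow> Ck_on k S f"
  by (induction k arbitrary: f) (auto intro: continuous_on_subset)

lemma Ck_on_imp_continuous_on: "Ck_on k S f \<Longrightarrow> continuous_on S f"
  by (cases k)
    (auto intro!: continuous_at_imp_continuous_on differentiable_imp_continuous_within)

lemma Ck_on_SucD: "Ck_on (Suc k) S f \<Longrightarrow> Ck_on k S f"
proof (induction k arbitrary: f)
  case 0
  then show ?case using Ck_on_imp_continuous_on[of "Suc 0" S f] by (simp del: Ck_on.simps add: Ck_on.simps(1))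
qed simp

text \<open>On an open set a derivative at a point depends only on nearby values inside the set, so
  agreement passes to all iterated directional derivatives.\<close>

lemma Ck_on_cong:
  assumes "open S" and "\<And>x. x \<in> S \<Longrightarrow> f x = g x" and "Ck_on k S f"
  shows "Ck_on k S g"
  using assms(2,3)
proof (induction k arbitrary: f g)
  case 0
  then show ?case by (simp cong: continuous_on_cong)
next
  case (Suc k)
  have "g differentiable (at x)" if "x \<in> S" for x
    using Suc.prems that \<open>open S\<close>
    by (auto simp: differentiable_def) (blast intro: has_derivative_transform_within_open)
  moreover have "frechet_derivative f (at x) = frechet_derivative g (at x)" if "x \<in> S" for x
    using Suc.prems that \<open>open S\<close> by (auto intro!: frechet_derivative_transform_within_open)
  ultimately show ?case
    using Suc.prems Suc.IH[of "\<lambda>x. frechet_derivative f (at x) v" "\<lambda>x. frechet_derivative g (at x) v" for v]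
    by simp
qed

text \<open>By uniqueness of the derivative, an explicit derivative formula may replace
  \<open>frechet_derivative\<close>. With \<open>Ck_on_SucE\<close> this turns each closure rule
  into an induction on the order, driven by the matching differentiation rule.\<close>

lemma Ck_on_SucI:
  assumes "open S" and "\<And>x. x \<in> S \<Longrightarrow> (f has_derivative f' x) (at x)"
    and "\<And>v. Ck_on k S (\<lambda>x. f' x v)"
  shows "Ck_on (Suc k) S f"
proof -
  have "frechet_derivative f (at x) = f' x" if "x \<in> S" for x
    using assms(2)[OF that] by (rule frechet_derivative_at[symmetric])
  then have "Ck_on k S (\<lambda>x. frechet_derivative f (at x) v)" for v
    by (intro Ck_on_cong[OF \<open>open S\<close> _ assms(3)[of v]]) simp
  with assms(2) show ?thesis by (auto simp: differentiable_def)
qed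

lemma Ck_on_SucE:
  assumes "Ck_on (Suc k) S f"
  obtains f' where "\<And>x. x \<in> S \<Longrightarrow> (f has_derivative f' x) (at x)"
    and "\<And>v. Ck_on k S (\<lambda>x. f' x v)"
  using assms that[of "\<lambda>x. frechet_derivative f (at x)"]
  by (auto simp: frechet_derivative_works)

lemma Ck_on_const: "open S \<Longrightarrow> Ck_on k S (\<lambda>x. c)"
  by (induction k arbitrary: c) (auto intro: Ck_on_SucI[OF _ has_derivative_const])

lemma Ck_on_linear_compose:
  assumes "open S" "bounded_linear L" "Ck_on k S f"
  shows "Ck_on k S (\<lambda>x. L (f x))"
  using assms(3)
proof (induction k arbitrary: f)
  case 0
  then show ?case using assms(2) by (simp add: linear_continuous_on_compose bounded_linear.continuous_on)
next
  case (Suc k)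
  then obtain f' where "\<And>x. x \<in> S \<Longrightarrow> (f has_derivative f' x) (at x)"
    and "\<And>v. Ck_on k S (\<lambda>x. f' x v)" by (elim Ck_on_SucE) blast
  then show ?case
    by (intro Ck_on_SucI[OF \<open>open S\<close>, where f'="\<lambda>x v. L (f' x v)"] Suc.IH
        bounded_linear.has_derivative[OF assms(2)])
qed

lemma Ck_on_id: "open S \<Longrightarrow> Ck_on k S (\<lambda>x. x)"
  by (cases k) (auto intro: Ck_on_SucI[OF _ has_derivative_ident] Ck_on_const)

lemma Ck_on_add:
  assumes "open S" "Ck_on k S f" "Ck_on k S g"
  shows "Ck_on k S (\<lambda>x. f x + g x)"
  using assms(2,3)
proof (induction k arbitrary: f g)
  case (Suc k)
  from Suc.prems(1) obtain f' where f': "\<And>x. x \<in> S \<Longrightarrow> (f has_derivative f' x) (at x)"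
    "\<And>v. Ck_on k S (\<lambda>x. f' x v)" by (elim Ck_on_SucE) blast
  from Suc.prems(2) obtain g' where g': "\<And>x. x \<in> S \<Longrightarrow> (g has_derivative g' x) (at x)"
    "\<And>v. Ck_on k S (\<lambda>x. g' x v)" by (elim Ck_on_SucE) blast
  show ?case
    by (intro Ck_on_SucI[OF \<open>open S\<close>, where f'="\<lambda>x v. f' x v + g' x v"] has_derivative_add Suc.IH f' g')
qed (simp add: continuous_on_add)

text \<open>The Leibniz rule expresses the derivative by the same bilinear map, so the induction
  closes. Here \<open>f\<close> and \<open>g\<close> themselves reappear and are needed one order
  lower, hence \<open>Ck_on_SucD\<close>. Real products, scalings and matrix products are all
  instances.\<close>

lemma Ck_on_bilinear:
  assumes "open S" and B: "bounded_bilinear B" and "Ck_on k S f" "Ck_on k S g"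
  shows "Ck_on k S (\<lambda>x. B (f x) (g x))"
  using assms(3,4)
proof (induction k arbitrary: f g)
  case 0
  then show ?case using B by (simp add: bounded_bilinear.continuous_on)
next
  case (Suc k)
  from Suc.prems(1) obtain f' where f': "\<And>x. x \<in> S \<Longrightarrow> (f has_derivative f' x) (at x)"
    "\<And>v. Ck_on k S (\<lambda>x. f' x v)" by (elim Ck_on_SucE) blast
  from Suc.prems(2) obtain g' where g': "\<And>x. x \<in> S \<Longrightarrow> (g has_derivative g' x) (at x)"
    "\<And>v. Ck_on k S (\<lambda>x. g' x v)" by (elim Ck_on_SucE) blast
  show ?case
    by (intro Ck_on_SucI[OF \<open>open S\<close>, where f'="\<lambda>x v. B (f x) (g' x v) + B (f' x v) (g x)"]
        bounded_bilinear.FDERIV[OF B] Ck_on_add Suc.IH f' g' \<open>open S\<close> Suc.prems[THEN Ck_on_SucD])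
qed

text \<open>The derivative of 1/f is - (1/f) f' (1/f), a product of f' with 1/f itself; the
  induction hypothesis supplies 1/f at the lower order.\<close>

lemma Ck_on_inverse:
  fixes f :: "'a::euclidean_space \<Rightarrow> real"
  assumes "open S" "Ck_on k S f" and nz: "\<And>x. x \<in> S \<Longrightarrow> f x \<noteq> 0"
  shows "Ck_on k S (\<lambda>x. inverse (f x))"
  using assms(2)
proof (induction k)
  case 0
  then show ?case using nz by (simp add: continuous_on_inverse)
next
  case (Suc k)
  note inv = Suc.IH[OF Ck_on_SucD[OF Suc.prems]]
  from Suc.prems obtain f' where f': "\<And>x. x \<in> S \<Longrightarrow> (f has_derivative f' x) (at x)"
    "\<And>v. Ck_on k S (\<lambda>x. f' x v)" by (elim Ck_on_SucE) blast
  show ?case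
  proof (rule Ck_on_SucI[OF \<open>open S\<close>, where f'="\<lambda>x v. - (inverse (f x) * f' x v * inverse (f x))"])
    show "((\<lambda>x. inverse (f x)) has_derivative (\<lambda>v. - (inverse (f x) * f' x v * inverse (f x)))) (at x)"
      if "x \<in> S" for x using Deriv.has_derivative_inverse[OF nz[OF that] f'(1)[OF that]] .
    show "Ck_on k S (\<lambda>x. - (inverse (f x) * f' x v * inverse (f x)))" for v
      by (intro Ck_on_linear_compose[OF \<open>open S\<close> bounded_linear_minus[OF bounded_linear_ident]]
          Ck_on_bilinear[OF \<open>open S\<close> bounded_bilinear_mult] inv f' \<open>open S\<close>)
  qed
qed

section \<open>Rules for smooth maps, collected for automatic use\<close>

named_theorems smooth_intros

lemma smooth_on_imp_continuous_on: "smooth_on S f \<Longrightarrow> continuous_on S f"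
  by (auto simp: smooth_on_def intro: Ck_on_imp_continuous_on)

text \<open>Openness is asked of \<open>T\<close> alone: the image of a chart overlap is treated by
  enclosing it in an explicit open set on which the coordinate expression has a closed
  formula.\<close>

lemma smooth_on_cong:
  assumes "open T" "smooth_on T g" "S \<subseteq> T" "\<And>x. x \<in> T \<Longrightarrow> f x = g x"
  shows "smooth_on S f"
  using assms Ck_on_cong[of T g f] by (auto simp: smooth_on_def intro: Ck_on_subset[of _ T])

context
  fixes S :: "'a::euclidean_space set"
  assumes S: "open S"
begin

lemma smooth_on_const [smooth_intros]: "smooth_on S (\<lambda>x. c)"
  and smooth_on_id [smooth_intros]: "smooth_on S (\<lambda>x. x)"
  by (simp_all add: smooth_on_def Ck_on_const Ck_on_id S)

lemma smooth_on_linear_compose: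
  "bounded_linear L \<Longrightarrow> smooth_on S f \<Longrightarrow> smooth_on S (\<lambda>x. L (f x))"
  by (simp add: smooth_on_def Ck_on_linear_compose S)

lemma smooth_on_bilinear:
  "bounded_bilinear B \<Longrightarrow> smooth_on S f \<Longrightarrow> smooth_on S g \<Longrightarrow> smooth_on S (\<lambda>x. B (f x) (g x))"
  by (simp add: smooth_on_def Ck_on_bilinear S)

lemma smooth_on_add [smooth_intros]:
  "smooth_on S f \<Longrightarrow> smooth_on S g \<Longrightarrow> smooth_on S (\<lambda>x. f x + g x)"
  by (simp add: smooth_on_def Ck_on_add S)

lemma smooth_on_inverse [smooth_intros]:
  fixes f :: "'a \<Rightarrow> real"
  shows "smooth_on S f \<Longrightarrow> (\<And>x. x \<in> S \<Longrightarrow> f x \<noteq> 0) \<Longrightarrow> smooth_on S (\<lambda>x. inverse (f x))"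
  by (simp add: smooth_on_def Ck_on_inverse S)

lemma smooth_on_sum [smooth_intros]:
  "(\<And>i. i \<in> I \<Longrightarrow> smooth_on S (f i)) \<Longrightarrow> smooth_on S (\<lambda>x. \<Sum>i\<in>I. f i x)"
  by (induction I rule: infinite_finite_induct) (auto intro: smooth_on_const smooth_on_add)

lemma smooth_on_prod [smooth_intros]:
  fixes f :: "'i \<Rightarrow> 'a \<Rightarrow> real"
  shows "(\<And>i. i \<in> I \<Longrightarrow> smooth_on S (f i)) \<Longrightarrow> smooth_on S (\<lambda>x. \<Prod>i\<in>I. f i x)"
  by (induction I rule: infinite_finite_induct)
    (auto intro: smooth_on_const smooth_on_bilinear bounded_bilinear_mult)

lemma smooth_on_Pair [smooth_intros]:
  assumes "smooth_on S f" "smooth_on S g"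
  shows "smooth_on S (\<lambda>x. (f x, g x))"
proof -
  have "smooth_on S (\<lambda>x. (f x, 0) + (0, g x))"
    by (intro smooth_on_add smooth_on_linear_compose[of "\<lambda>y. (y, 0)"]
        smooth_on_linear_compose[of "Pair 0"] assms bounded_linear_Pair
        bounded_linear_ident bounded_linear_zero)
  then show ?thesis by simp
qed

lemma smooth_on_fst [smooth_intros]: "smooth_on S f \<Longrightarrow> smooth_on S (\<lambda>x. fst (f x))"
  and smooth_on_snd [smooth_intros]: "smooth_on S g \<Longrightarrow> smooth_on S (\<lambda>x. snd (g x))"
  by (rule smooth_on_linear_compose[OF bounded_linear_fst] smooth_on_linear_compose[OF bounded_linear_snd]; assumption)+

lemma smooth_on_nth: "smooth_on S f \<Longrightarrow> smooth_on S (\<lambda>x. f x $ i)"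
  by (rule smooth_on_linear_compose[OF bounded_linear_vec_nth])

text \<open>A vector is the sum of its components placed on the axes, and each placement
  \<open>axis i\<close> is linear.\<close>

lemma smooth_on_vec_lambda:
  fixes f :: "'a \<Rightarrow> 'n::finite \<Rightarrow> 'c::euclidean_space"
  assumes "\<And>i. smooth_on S (\<lambda>x. f x i)"
  shows "smooth_on S (\<lambda>x. \<chi> i. f x i)"
proof -
  have "smooth_on S (\<lambda>x. \<Sum>i\<in>UNIV. axis i (f x i))"
    using assms
    by (intro smooth_on_sum smooth_on_linear_compose[of "axis i" for i])
      (auto simp: linear_conv_bounded_linear[symmetric] axis_def vec_eq_iff intro!: linearI)
  moreover have "(\<Sum>i\<in>UNIV. axis i (f x i)) = (\<chi> i. f x i)" for x
    by (simp add: vec_eq_iff axis_def if_distrib[of "\<lambda>v. v $ _"] cong: if_cong)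
  ultimately show ?thesis by simp
qed


lemma smooth_on_det:
  fixes f :: "'a \<Rightarrow> real^'n^'n"
  assumes "\<And>i j. smooth_on S (\<lambda>x. f x $ i $ j)"
  shows "smooth_on S (\<lambda>x. det (f x))"
  unfolding det_def
  by (intro smooth_on_sum smooth_on_bilinear[OF bounded_bilinear_mult] smooth_on_const smooth_on_prod assms)

end

section \<open>Matrix products, transposes and inverses as smooth operations\<close>

lemma bounded_bilinear_matrix_mult:
  "bounded_bilinear ((**) :: real^'n^'m \<Rightarrow> real^'k^'n \<Rightarrow> real^'k^'m)"
  unfolding bilinear_conv_bounded_bilinear[symmetric] bilinear_def
  by (intro conjI allI linearI)
    (simp_all add: matrix_matrix_mult_def vec_eq_iff algebra_simps sum.distrib sum_distrib_left)

lemma bounded_linear_transpose: "bounded_linear (transpose :: real^'n^'m \<Rightarrow> real^'m^'n)"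
  unfolding linear_conv_bounded_linear[symmetric]
  by (intro linearI) (simp_all add: transpose_def vec_eq_iff)

lemma matrix_inv_mult:
  assumes "invertible A"
  shows "A ** matrix_inv A = mat 1" "matrix_inv A ** A = mat 1"
proof -
  have "A ** matrix_inv A = mat 1 \<and> matrix_inv A ** A = mat 1"
    unfolding matrix_inv_def by (rule someI_ex) (use assms in \<open>simp add: invertible_def\<close>)
  then show "A ** matrix_inv A = mat 1" "matrix_inv A ** A = mat 1" by auto
qed

text \<open>Column j of the inverse solves A x = e_j, so Cramer's rule applies column by column. The
  formula is rational in the entries, which makes inversion smooth.\<close>

lemma matrix_inv_cramer:
  fixes A :: "real^'n^'n"
  assumes "invertible A"
  shows "matrix_inv A =
    (\<chi> k j. det (\<chi> i l. if l = k then (if i = j then 1 else 0) else A $ i $ l) * inverse (det A))"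
proof -
  have "matrix_inv A $ k $ j =
      det (\<chi> i l. if l = k then (if i = j then 1 else 0) else A $ i $ l) * inverse (det A)" for k j
  proof -
    have "A *v column j (matrix_inv A) = (\<chi> i. if i = j then 1 else 0)"
      using matrix_inv_mult(1)[OF assms]
      by (simp add: column_def matrix_vector_mult_def matrix_matrix_mult_def mat_def vec_eq_iff)
    then have "column j (matrix_inv A) =
        (\<chi> k. det (\<chi> i l. if l = k then (\<chi> i. if i = j then 1 else 0) $ i else A $ i $ l) / det A)"
      using assms by (subst (asm) cramer) (auto simp: invertible_det_nz)
    then show ?thesis by (simp add: column_def vec_eq_iff divide_inverse cong: if_cong)
  qed
  then show ?thesis by (simp add: vec_eq_iff)
qed

context
  fixes S :: "'a::euclidean_space set"
  assumes S: "open S"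
begin

lemma smooth_on_matrix_mult [smooth_intros]:
  fixes f :: "'a \<Rightarrow> real^'n^'m" and g :: "'a \<Rightarrow> real^'k^'n"
  shows "smooth_on S f \<Longrightarrow> smooth_on S g \<Longrightarrow> smooth_on S (\<lambda>x. f x ** g x)"
  by (rule smooth_on_bilinear[OF S bounded_bilinear_matrix_mult])

lemma smooth_on_matrix_vector_mult [smooth_intros]:
  fixes A :: "real^'n^'m"
  shows "smooth_on S g \<Longrightarrow> smooth_on S (\<lambda>x. A *v g x)"
  by (rule smooth_on_linear_compose[OF S]) simp_all

lemma smooth_on_transpose [smooth_intros]:
  fixes f :: "'a \<Rightarrow> real^'n^'m"
  shows "smooth_on S f \<Longrightarrow> smooth_on S (\<lambda>x. transpose (f x))"
  by (rule smooth_on_linear_compose[OF S bounded_linear_transpose])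

lemma smooth_on_matrix_inv [smooth_intros]:
  fixes f :: "'a \<Rightarrow> real^'n^'n"
  assumes f: "smooth_on S f" and inv: "\<And>x. x \<in> S \<Longrightarrow> invertible (f x)"
  shows "smooth_on S (\<lambda>x. matrix_inv (f x))"
proof (rule smooth_on_cong[OF S _ order_refl matrix_inv_cramer[OF inv]])
  have entries: "smooth_on S (\<lambda>x. f x $ i $ j)" for i j
    by (intro smooth_on_nth[OF S] f)
  show "smooth_on S (\<lambda>x. \<chi> k j.
      det (\<chi> i l. if l = k then (if i = j then 1 else 0) else f x $ i $ l) * inverse (det (f x)))"
  proof (intro smooth_on_vec_lambda[OF S] smooth_on_bilinear[OF S bounded_bilinear_mult]
      smooth_on_inverse[OF S] smooth_on_det[OF S] entries)
    show "smooth_on S (\<lambda>x. (\<chi> i l. if l = k then (if i = j then 1 else 0) else f x $ i $ l) $ i' $ l')"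
      for k j i' l' :: 'n by (cases "l' = k") (auto intro: smooth_on_const[OF S] entries)
    show "det (f x) \<noteq> 0" if "x \<in> S" for x using inv[OF that] by (simp add: invertible_det_nz)
  qed
qed

end

text \<open>Invertibility is non-vanishing of the determinant, an open condition on a continuous
  family of matrices.\<close>

lemma open_invertible_preimage:
  fixes f :: "'a::topological_space \<Rightarrow> real^'n^'n"
  assumes "continuous_on UNIV f"
  shows "open {x. invertible (f x)}"
proof -
  have "continuous_on UNIV (\<lambda>A :: real^'n^'n. det A)"
    by (intro smooth_on_imp_continuous_on smooth_on_det smooth_on_nth smooth_on_id open_UNIV)
  then have "continuous_on UNIV (\<lambda>x. det (f x))"
    using assms by (rule continuous_on_compose2) simp
  then show ?thesis
    by (simp add: invertible_det_nz open_Collect_neq continuous_on_const)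
qed

section \<open>Splittings and graph coordinates\<close>

abbreviation colspace :: "real^'n^'m \<Rightarrow> (real^'m) set"
  where "colspace X \<equiv> range ((*v) X)"

section \<open>Column spaces and full-rank matrices\<close>

lemma inj_matrix_mult_iff_ker:
  fixes X :: "real^'n^'m"
  shows "inj ((*v) X) \<longleftrightarrow> (\<forall>v. X *v v = 0 \<longrightarrow> v = 0)"
  by (metis matrix_left_invertible_injective matrix_left_invertible_ker)

lemma invertible_iff_ker:
  fixes A :: "real^'n^'n"
  shows "invertible A \<longleftrightarrow> (\<forall>v. A *v v = 0 \<longrightarrow> v = 0)"
  by (metis invertible_left_inverse matrix_left_invertible_ker)

lemma invertible_mat_1: "invertible (mat 1 :: real^'n^'n)"
  by (simp add: invertible_iff_ker)

lemma matrix_add_rdistrib: "(A + B) ** C = A ** C + B ** (C :: 'a::semiring_1^'k^'n)"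
  by (simp add: matrix_matrix_mult_def vec_eq_iff distrib_right sum.distrib)

lemma invertible_transpose_iff: "invertible (transpose A) \<longleftrightarrow> invertible (A :: real^'n^'n)"
  by (simp add: invertible_det_nz)

lemma invertible_matrix_inv: "invertible A \<Longrightarrow> invertible (matrix_inv A)"
  using matrix_inv_mult[of A] by (auto simp: invertible_def)

lemma colspace_mult_invertible:
  fixes X :: "real^'n^'m"
  assumes "invertible A"
  shows "colspace (X ** A) = colspace X"
proof -
  have "X *v v \<in> colspace (X ** A)" for v
  proof (rule range_eqI)
    show "X *v v = (X ** A) *v (matrix_inv A *v v)"
      by (metis assms matrix_inv_mult(1) matrix_mul_rid matrix_mul_assoc matrix_vector_mul_assoc)
  qed
  then show ?thesis by (auto simp: matrix_vector_mul_assoc[symmetric])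
qed

text \<open>The change of basis is \<open>L ** Y\<close> for a left inverse \<open>L\<close> of
  \<open>X\<close>, because \<open>X ** L\<close> fixes every vector of the common column space.
  Together with \<open>colspace_mult_invertible\<close> this identifies the fibres of the column
  space map on full-rank matrices with the orbits of right multiplication.\<close>

lemma colspace_eqE:
  fixes X Y :: "real^'n^'m"
  assumes "inj ((*v) X)" "inj ((*v) Y)" "colspace X = colspace Y"
  obtains A where "invertible A" "Y = X ** A"
proof -
  from assms(1) obtain L where L: "L ** X = mat 1"
    using matrix_left_invertible_injective by metis
  have *: "Y = X ** (L ** Y)"
    unfolding matrix_eq
  proof
    fix v
    from assms(3) obtain w where w: "Y *v v = X *v w" by blast
    have "X *v (L *v (X *v w)) = X *v w" by (simp add: matrix_vector_mul_assoc L)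
    then show "Y *v v = X ** (L ** Y) *v v"
      by (simp add: matrix_vector_mul_assoc[symmetric] w)
  qed
  have "invertible (L ** Y)"
    unfolding invertible_iff_ker
  proof (intro allI impI)
    fix v assume "L ** Y *v v = 0"
    then have "X ** (L ** Y) *v v = 0" by (metis matrix_vector_mul_assoc matrix_vector_mult_0_right)
    then show "v = 0" using assms(2) unfolding *[symmetric] inj_matrix_mult_iff_ker by blast
  qed
  with * that show thesis by blast
qed

lemma subspace_eq_colspace:
  fixes W :: "(real^'m) set"
  assumes "subspace W" "dim W = CARD('n)"
  obtains X :: "real^'n^'m" where "inj ((*v) X)" "W = colspace X"
proof -
  obtain B where B: "B \<subseteq> W" "independent B" "W \<subseteq> span B" "card B = dim W"
    using basis_exists by blast
  then have "card (UNIV :: 'n set) = card B" "finite B"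
    using assms(2) by (auto intro: independent_imp_finite)
  then obtain h where h: "bij_betw h (UNIV :: 'n set) B"
    using finite_same_card_bij by (metis finite_class.finite_UNIV)
  \<comment> \<open>The columns are a basis of \<open>W\<close>, enumerated by the index type
    \<open>'n\<close>.\<close>
  define X :: "real^'n^'m" where "X = (\<chi> i j. h j $ i)"
  have cols: "columns X = B"
    using h by (auto simp: columns_def column_def X_def bij_betw_def)
  have "colspace X = span B"
  proof
    show "colspace X \<subseteq> span B"
      using matrix_vector_mult_in_columnspace[of X] by (auto simp: cols)
    show "span B \<subseteq> colspace X"
      unfolding cols[symmetric] columns_image_basis
      by (rule span_minimal) (auto simp: linear_subspace_image)
  qed
  also have "span B = W"
    using B assms(1) by (metis span_minimal subset_antisym)
  finally have "W = colspace X" by simp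
  moreover have "inj ((*v) X)"
    using assms(2) \<open>W = colspace X\<close> by (simp add: full_rank_injective[symmetric] rank_dim_range)
  ultimately show thesis using that by blast
qed

lemma colspace_in_Gr25: "X \<in> frames25 \<Longrightarrow> colspace X \<in> Gr25"
  using full_rank_injective[of X]
  by (simp add: Gr25_def frames25_def rank_dim_range linear_subspace_image)

lemma Gr25_frame:
  assumes "W \<in> Gr25"
  obtains X where "X \<in> frames25" "W = colspace X"
  using assms subspace_eq_colspace[where 'n=2, of W] by (auto simp: Gr25_def frames25_def)

text \<open>The block column of \<open>P\<close> and \<open>Q\<close> is a two-sided inverse of the
  block row of \<open>E\<close> and \<open>F\<close>. These five equations replace the bijectivity
  in the definition of the charts and can be used for rewriting.\<close>

definition splitting :: "real^'k^'n \<Rightarrow> real^'l^'n \<Rightarrow> real^'n^'k \<Rightarrow> real^'n^'l \<Rightarrow> bool"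
  where "splitting E F P Q \<longleftrightarrow> P ** E = mat 1 \<and> P ** F = 0 \<and> Q ** E = 0 \<and> Q ** F = mat 1 \<and>
    E ** P + F ** Q = mat 1"

lemma splitting_exists:
  fixes E :: "real^'k^'n" and F :: "real^'l^'n"
  assumes "bij (\<lambda>(x, y). E *v x + F *v y)"
  obtains P Q where "splitting E F P Q"
proof -
  let ?f = "\<lambda>(x, y). E *v x + F *v y"
  have lin: "linear ?f"
    by (intro linearI) (auto simp: algebra_simps)
  obtain g where g: "linear g" "g \<circ> ?f = id"
    using linear_injective_left_inverse[OF lin] assms by (auto simp: bij_def)
  \<comment> \<open>\<open>g\<close> was obtained only as a left inverse; surjectivity of the map
    makes it a right inverse as well.\<close>
  have fg: "?f (g w) = w" for w
  proof -
    obtain z where "w = ?f z" by (rule surjE[OF bij_is_surj[OF assms]])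
    then show ?thesis using fun_cong[OF g(2), of z] by simp
  qed
  have gf: "g (E *v x + F *v y) = (x, y)" for x y
    using fun_cong[OF g(2), of "(x, y)"] by simp
  have P: "matrix (fst \<circ> g) *v w = fst (g w)" and Q: "matrix (snd \<circ> g) *v w = snd (g w)" for w
    using linear_compose[OF g(1) linear_fst] linear_compose[OF g(1) linear_snd]
    by (simp_all add: matrix_works)
  have "splitting E F (matrix (fst \<circ> g)) (matrix (snd \<circ> g))"
    unfolding splitting_def matrix_eq
    using gf[of _ 0] gf[of 0] fg
    by (simp add: matrix_vector_mul_assoc[symmetric] P Q algebra_simps case_prod_beta)
  then show thesis by (rule that)
qed

text \<open>\<open>F\<close> is a basis matrix of the orthogonal complement of the column space of
  \<open>E\<close>, whose dimension is the complementary one.\<close>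

lemma complement_exists:
  fixes E :: "real^'k^'n"
  assumes "inj ((*v) E)" "CARD('k) + CARD('l) = CARD('n)"
  obtains F :: "real^'l^'n" where "bij (\<lambda>(x, y). E *v x + F *v y)"
proof -
  define C where "C = {y \<in> UNIV. \<forall>x \<in> colspace E. orthogonal x y}"
  have "subspace C"
    by (auto simp: subspace_def C_def orthogonal_clauses)
  have "dim (colspace E) = CARD('k)"
    using assms(1) by (simp add: full_rank_injective[symmetric] rank_dim_range)
  then have "dim C = CARD('l)"
    using dim_subspace_orthogonal_to_vectors[of "colspace E" UNIV] assms(2)
    by (simp add: C_def linear_subspace_image)
  then obtain F :: "real^'l^'n" where F: "inj ((*v) F)" "C = colspace F"
    using subspace_eq_colspace \<open>subspace C\<close> by metis
  let ?f = "\<lambda>(x, y). E *v x + F *v y"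
  have lin: "linear ?f"
    by (intro linearI) (auto simp: algebra_simps)
  have "x = 0 \<and> y = 0" if "E *v x + F *v y = 0" for x y
  proof -
    have "(E *v x) \<bullet> (F *v y) = 0"
      using F(2) by (auto simp: C_def orthogonal_def)
    \<comment> \<open>The two vectors are opposite and orthogonal, hence both zero.\<close>
    moreover have "F *v y = - (E *v x)" using that by (simp add: eq_neg_iff_add_eq_0 add.commute)
    ultimately have "E *v x = 0" "F *v y = 0" by auto
    then show ?thesis using F(1) assms(1) by (simp add: inj_matrix_mult_iff_ker)
  qed
  then have "inj ?f"
    unfolding linear_injective_0[OF lin] by (force simp: zero_prod_def)
  moreover have "surj ?f"
    using lin \<open>inj ?f\<close> by (rule linear_injective_imp_surjective) (simp add: assms(2))
  ultimately show thesis using that by (auto simp: bij_def)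
qed

section \<open>Graph coordinates of planes relative to a fixed splitting\<close>

context
  fixes E :: "real^2^5" and F :: "real^3^5" and P :: "real^5^2" and Q :: "real^5^3"
  assumes split: "splitting E F P Q"
begin

lemma splitting_eqs:
  "P ** E = mat 1" "P ** F = 0" "Q ** E = 0" "Q ** F = mat 1" "E ** P + F ** Q = mat 1"
  using split by (auto simp: splitting_def)

text \<open>The kernel of \<open>X\<close> lies in the kernel of \<open>P ** X\<close>.\<close>

lemma splitting_frame: "invertible (P ** X) \<Longrightarrow> X \<in> frames25"
  unfolding frames25_def mem_Collect_eq inj_matrix_mult_iff_ker invertible_iff_ker
  by (metis matrix_vector_mul_assoc matrix_vector_mult_0_right)

text \<open>Since X v = E (P X v) + F (Q X v), the vector X v lies in the column space of
  \<open>F\<close> exactly when P X v = 0. Transversality therefore becomes a determinant condition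
  on any frame of the plane.\<close>

lemma splitting_transverse_iff:
  assumes "X \<in> frames25"
  shows "colspace X \<in> Gr25_chart_domain F \<longleftrightarrow> invertible (P ** X)"
proof
  assume "colspace X \<in> Gr25_chart_domain F"
  then have tr: "colspace X \<inter> colspace F = {0}" by (simp add: Gr25_chart_domain_def)
  show "invertible (P ** X)" unfolding invertible_iff_ker
  proof (intro allI impI)
    fix v assume v: "P ** X *v v = 0"
    have "X *v v = (E ** P + F ** Q) *v (X *v v)" by (simp add: splitting_eqs)
    also have "\<dots> = E *v (P ** X *v v) + F *v (Q *v (X *v v))"
      by (simp add: matrix_vector_mult_add_rdistrib matrix_vector_mul_assoc matrix_mul_assoc matrix_add_rdistrib)
    finally have "X *v v = F *v (Q *v (X *v v))" by (simp add: v)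
    with tr have "X *v v = 0" by blast
    then show "v = 0" using assms by (simp add: frames25_def inj_matrix_mult_iff_ker)
  qed
next
  assume inv: "invertible (P ** X)"
  have "X *v v = 0" if "X *v v = F *v w" for v w
  proof -
    have "P ** X *v v = P ** F *v w" using that by (simp add: matrix_vector_mul_assoc[symmetric])
    then have "P ** X *v v = 0" by (simp add: splitting_eqs)
    with inv have "v = 0" by (simp add: invertible_iff_ker)
    then show ?thesis by simp
  qed
  then have "colspace X \<inter> colspace F = {0}"
    by (auto intro: range_eqI[of _ _ 0])
  then show "colspace X \<in> Gr25_chart_domain F"
    using assms by (simp add: Gr25_chart_domain_def colspace_in_Gr25)
qed

text \<open>Right multiplication by the inverse of \<open>P ** X\<close> keeps the plane and makes
  the \<open>E\<close>-component the identity; what remains is the graph matrix in the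
  \<open>F\<close>-component.\<close>

lemma splitting_normalize:
  assumes "invertible (P ** X)"
  shows "E + F ** (Q ** X ** matrix_inv (P ** X)) = X ** matrix_inv (P ** X)"
proof -
  have "X ** matrix_inv (P ** X) = (E ** P + F ** Q) ** (X ** matrix_inv (P ** X))"
    by (simp add: splitting_eqs)
  also have "\<dots> = E ** (P ** X ** matrix_inv (P ** X)) + F ** (Q ** X ** matrix_inv (P ** X))"
    by (simp add: matrix_add_rdistrib matrix_mul_assoc)
  finally show ?thesis by (simp add: matrix_inv_mult(1)[OF assms])
qed

lemma splitting_graph:
  "P ** (E + F ** M) = mat 1" "Q ** (E + F ** M) = M"
  by (simp_all add: matrix_add_ldistrib matrix_mul_assoc splitting_eqs)

lemma splitting_graph_frame: "E + F ** M \<in> frames25"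
  by (rule splitting_frame) (simp add: splitting_graph invertible_mat_1)

lemma Gr25_chart_colspace_graph: "Gr25_chart E F (colspace (E + F ** M)) = M"
  unfolding Gr25_chart_def
proof (rule the_equality)
  fix M' assume eq: "colspace (E + F ** M) = colspace (E + F ** M')"
  show "M' = M" unfolding matrix_eq
  proof
    fix v
    from eq obtain w where w: "(E + F ** M') *v v = (E + F ** M) *v w" by blast
    \<comment> \<open>Applying \<open>P\<close> gives v = w; applying \<open>Q\<close> then gives M'
      v = M w.\<close>
    from arg_cong[OF w, of "(*v) P"] arg_cong[OF w, of "(*v) Q"]
    show "M' *v v = M *v v" by (simp add: matrix_vector_mul_assoc splitting_graph)
  qed
qed simp

lemma Gr25_chart_colspace:
  assumes "invertible (P ** X)"
  shows "Gr25_chart E F (colspace X) = Q ** X ** matrix_inv (P ** X)"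
  using Gr25_chart_colspace_graph[of "Q ** X ** matrix_inv (P ** X)"]
  by (simp add: splitting_normalize assms colspace_mult_invertible invertible_matrix_inv)

lemma colspace_graph_mem: "colspace (E + F ** M) \<in> Gr25_chart_domain F"
  using splitting_transverse_iff[OF splitting_graph_frame]
  by (simp add: splitting_graph invertible_mat_1)

lemma Gr25_chart_domain_eq: "Gr25_chart_domain F = range (\<lambda>M. colspace (E + F ** M))"
proof -
  have "W \<in> range (\<lambda>M. colspace (E + F ** M))" if W: "W \<in> Gr25_chart_domain F" for W
  proof -
    from W obtain X where X: "X \<in> frames25" "W = colspace X"
      by (auto simp: Gr25_chart_domain_def elim: Gr25_frame)
    then have "invertible (P ** X)" using W splitting_transverse_iff by blast
    then have "W = colspace (E + F ** (Q ** X ** matrix_inv (P ** X)))"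
      by (simp add: splitting_normalize colspace_mult_invertible invertible_matrix_inv X)
    then show ?thesis by blast
  qed
  then show ?thesis using colspace_graph_mem by blast
qed

lemma Gr25_chart_image: "Gr25_chart E F ` Gr25_chart_domain F = UNIV"
  by (auto simp: Gr25_chart_domain_eq image_image Gr25_chart_colspace_graph)

lemma inv_into_Gr25_chart:
  "inv_into (Gr25_chart_domain F) (Gr25_chart E F) M = colspace (E + F ** M)"
  by (rule inv_into_f_eq) (auto simp: Gr25_chart_domain_eq Gr25_chart_colspace_graph inj_on_def)

end

section \<open>The topology of the Grassmannian\<close>

text \<open>The identity |X v|^2 = (X^T X v) . v shows that X and its Gram matrix have the same
  kernel. Full rank is thus invertibility of a square matrix, which yields openness of the frames
  and the projection formula below.\<close>

lemma frame_iff_gram: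
  fixes X :: "real^'n^'m"
  shows "inj ((*v) X) \<longleftrightarrow> invertible (transpose X ** X)"
proof -
  have "X *v v = 0" if "transpose X ** X *v v = 0" for v
  proof -
    have "(X *v v) \<bullet> (X *v v) = (transpose X *v (X *v v)) \<bullet> v"
      by (simp add: dot_lmul_matrix)
    also have "\<dots> = 0" using that by (simp only: matrix_vector_mul_assoc inner_zero_left)
    finally show ?thesis by simp
  qed
  then have "transpose X ** X *v v = 0 \<longleftrightarrow> X *v v = 0" for v
    by (metis matrix_vector_mul_assoc matrix_vector_mult_0_right)
  then show ?thesis by (simp add: inj_matrix_mult_iff_ker invertible_iff_ker)
qed

lemma frames25_mult_iff: "invertible A \<Longrightarrow> X ** A \<in> frames25 \<longleftrightarrow> X \<in> frames25"
  unfolding frames25_def mem_Collect_eq full_rank_injective[symmetric] rank_dim_range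
  by (simp add: colspace_mult_invertible)

lemma matrix_inv_unique:
  assumes "A ** B = mat 1" "B ** A = mat 1"
  shows "matrix_inv A = B"
  by (metis assms invertible_def matrix_inv_mult(2) matrix_mul_assoc matrix_mul_lid matrix_mul_rid)

lemma matrix_inv_mult_distrib:
  assumes "invertible A" "invertible B"
  shows "matrix_inv (A ** B) = matrix_inv B ** matrix_inv A"
proof (rule matrix_inv_unique)
  have "A ** B ** (matrix_inv B ** matrix_inv A) = A ** (B ** matrix_inv B) ** matrix_inv A"
    "matrix_inv B ** matrix_inv A ** (A ** B) = matrix_inv B ** (matrix_inv A ** A) ** B"
    by (simp_all only: matrix_mul_assoc)
  then show "A ** B ** (matrix_inv B ** matrix_inv A) = mat 1"
    "matrix_inv B ** matrix_inv A ** (A ** B) = mat 1"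
    by (simp_all add: matrix_inv_mult assms)
qed

lemma open_frames25: "open frames25"
proof -
  have "frames25 = {X. invertible (transpose X ** X)}"
    by (simp add: frames25_def frame_iff_gram)
  moreover have "continuous_on UNIV (\<lambda>X :: real^2^5. transpose X ** X)"
    by (intro smooth_on_imp_continuous_on smooth_intros open_UNIV)
  ultimately show ?thesis
    using open_invertible_preimage[of "\<lambda>X :: real^2^5. transpose X ** X"] by simp
qed

lemma openin_Gr25_iff:
  "openin Gr25_topology U \<longleftrightarrow> U \<subseteq> Gr25 \<and> open {X \<in> frames25. colspace X \<in> U}"
  by (auto simp: openin_Gr25_topology openin_open_eq[OF open_frames25])

lemma continuous_map_colspace: "continuous_map (top_of_set frames25) Gr25_topology colspace"
  by (auto simp: continuous_map_def topspace_Gr25_topology colspace_in_Gr25 openin_Gr25_topology)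

lemma continuous_map_into_Gr25:
  assumes "continuous_on S f" "f ` S \<subseteq> frames25"
  shows "continuous_map (top_of_set S) Gr25_topology (\<lambda>x. colspace (f x))"
  using continuous_map_compose[OF _ continuous_map_colspace, of "top_of_set S" f] assms
  by (auto simp: o_def image_subset_iff_funcset)

text \<open>The universal property of the quotient topology, restricted to an open piece: continuity
  is tested after composition with the column space map.\<close>

lemma continuous_map_from_Gr25:
  assumes D: "openin Gr25_topology D"
    and "continuous_on {X \<in> frames25. colspace X \<in> D} (\<lambda>X. g (colspace X))"
  shows "continuous_map (subtopology Gr25_topology D) euclidean g"
  unfolding continuous_map_def
proof (intro conjI allI impI)
  have "D \<subseteq> Gr25" using D by (simp add: openin_Gr25_iff)
  fix U assume "openin (euclidean :: 'a topology) U"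
  have eq: "{X \<in> frames25. colspace X \<in> {W \<in> D. g W \<in> U}} =
      {X \<in> frames25. colspace X \<in> D} \<inter> (\<lambda>X. g (colspace X)) -` U" by auto
  have "open {X \<in> frames25. colspace X \<in> {W \<in> D. g W \<in> U}}"
    unfolding eq
    using \<open>openin euclidean U\<close> D assms(2)
    by (intro continuous_open_preimage) (auto simp: openin_Gr25_iff)
  then have "openin Gr25_topology {W \<in> D. g W \<in> U}"
    using \<open>D \<subseteq> Gr25\<close> by (auto simp: openin_Gr25_iff)
  then show "openin (subtopology Gr25_topology D)
      {x \<in> topspace (subtopology Gr25_topology D). g x \<in> U}"
    using \<open>D \<subseteq> Gr25\<close> D by (simp add: openin_open_subtopology topspace_Gr25_topology Int_absorb1)
qed simp

text \<open>The orthogonal projection onto a plane embeds the Grassmannian into the matrices.\<close>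

lemma Hausdorff_Gr25: "Hausdorff_space Gr25_topology"
proof -
  define pr :: "real^2^5 \<Rightarrow> real^5^5"
    where "pr X = X ** matrix_inv (transpose X ** X) ** transpose X" for X
  \<comment> \<open>An arbitrary frame is chosen for each plane; \<open>pr_mult\<close> shows that
    the result does not depend on it.\<close>
  define g where "g W = pr (SOME X. X \<in> frames25 \<and> colspace X = W)" for W
  have inv: "invertible (transpose X ** X)" if "X \<in> frames25" for X
    using that by (simp add: frames25_def frame_iff_gram[symmetric])
  have pr_mult: "pr (X ** A) = pr X" if "X \<in> frames25" "invertible A" for X A
  proof -
    let ?G = "transpose X ** X"
    have tA: "invertible (transpose A)" using that by (simp add: invertible_transpose_iff)
    \<comment> \<open>The Gram matrix of \<open>X ** A\<close> is A^T G A. Its inverse is split into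
      three factors so that the outer ones cancel against \<open>A\<close> and its
      transpose.\<close>
    have "matrix_inv (transpose A ** ?G ** A) = matrix_inv A ** matrix_inv (transpose A ** ?G)"
      using that(2) by (intro matrix_inv_mult_distrib invertible_mult[OF tA inv[OF that(1)]])
    also have "matrix_inv (transpose A ** ?G) = matrix_inv ?G ** matrix_inv (transpose A)"
      using tA inv[OF that(1)] by (rule matrix_inv_mult_distrib)
    finally have "matrix_inv (transpose A ** ?G ** A)
        = matrix_inv A ** (matrix_inv ?G ** matrix_inv (transpose A))" .
    then have "pr (X ** A) = X ** (A ** matrix_inv A) ** matrix_inv (transpose X ** X) **
        (matrix_inv (transpose A) ** transpose A) ** transpose X"
      by (simp add: pr_def matrix_transpose_mul matrix_mul_assoc)
    then show ?thesis
      using that by (simp add: matrix_inv_mult invertible_transpose_iff pr_def)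
  qed
  have g: "g (colspace X) = pr X" if X: "X \<in> frames25" for X
  proof -
    define Y where "Y = (SOME Y. Y \<in> frames25 \<and> colspace Y = colspace X)"
    have "Y \<in> frames25 \<and> colspace Y = colspace X"
      unfolding Y_def by (rule someI[of _ X]) (simp add: X)
    then obtain A where "invertible A" "Y = X ** A"
      using X colspace_eqE[of X Y] by (auto simp: frames25_def)
    then show ?thesis using pr_mult[OF X] by (simp add: g_def Y_def[symmetric])
  qed
  have range_pr: "colspace (pr X) = colspace X" if "X \<in> frames25" for X
  proof
    show "colspace (pr X) \<subseteq> colspace X"
      by (auto simp: pr_def matrix_vector_mul_assoc[symmetric] simp del: transpose_matrix_vector)
    \<comment> \<open>The projection fixes the columns of \<open>X\<close>, so its range is the
      plane itself. A plane is thus recovered from its projection, which gives injectivity of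
      \<open>g\<close>.\<close>
    have "pr X ** X = X"
      by (metis inv matrix_inv_mult(2) matrix_mul_assoc matrix_mul_rid pr_def that)
    then show "colspace X \<subseteq> colspace (pr X)"
      by (metis image_subsetI matrix_vector_mul_assoc rangeI)
  qed
  have "inj_on g Gr25"
  proof (rule inj_onI)
    fix V W assume "V \<in> Gr25" "W \<in> Gr25" "g V = g W"
    then show "V = W" by (metis Gr25_frame g range_pr)
  qed
  have top: "openin Gr25_topology Gr25" by (metis openin_topspace topspace_Gr25_topology)
  have "continuous_on frames25 pr"
    unfolding pr_def
    by (intro smooth_on_imp_continuous_on smooth_intros open_frames25 inv)
  then have "continuous_on {X \<in> frames25. colspace X \<in> Gr25} (\<lambda>X. g (colspace X))"
    by (rule continuous_on_eq[OF continuous_on_subset]) (auto simp: g)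
  from continuous_map_from_Gr25[OF top this]
  have "continuous_map Gr25_topology euclidean g"
    by (metis subtopology_topspace topspace_Gr25_topology)
  then show ?thesis
    using \<open>inj_on g Gr25\<close>
    by (intro Hausdorff_space_injective_preimage[where Y = euclidean and f = g])
      (auto simp: topspace_Gr25_topology Hausdorff_space_euclidean)
qed

lemma second_countable_euclidean:
  "second_countable (euclidean :: 'a::second_countable_topology topology)"
proof -
  obtain \<B> :: "'a set set" where "countable \<B>" "\<And>V. V \<in> \<B> \<Longrightarrow> open V"
    "\<And>S. open S \<Longrightarrow> \<exists>\<U>. \<U> \<subseteq> \<B> \<and> S = \<Union>\<U>"
    using univ_second_countable by blast
  then show ?thesis
    unfolding second_countable_def open_openin[symmetric]
    by (intro exI[of _ \<B>]) (metis Union_iff Union_upper subsetD)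
qed

text \<open>The column space map is open: the saturation of an open set \<open>U\<close> of frames
  is the union, over invertible \<open>A\<close>, of its preimages under right multiplication by
  \<open>A\<close>. Second countability passes to the image of a continuous open map.\<close>

lemma second_countable_Gr25: "second_countable Gr25_topology"
proof (rule second_countable_open_map_image[OF continuous_map_colspace])
  show "second_countable (top_of_set frames25)"
    by (rule second_countable_subtopology) (rule second_countable_euclidean)
  show "colspace ` topspace (top_of_set frames25) = topspace Gr25_topology"
    by (auto simp: topspace_Gr25_topology colspace_in_Gr25 elim: Gr25_frame)
  show "open_map (top_of_set frames25) Gr25_topology colspace"
    unfolding open_map_def
  proof (intro allI impI)
    fix U assume "openin (top_of_set frames25) U"
    then have U: "open U" "U \<subseteq> frames25"
      by (auto simp: openin_open_eq[OF open_frames25])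
    have "{X \<in> frames25. colspace X \<in> colspace ` U} = (\<Union>A\<in>{A :: real^2^2. invertible A}. (\<lambda>X. X ** A) -` U)"
    proof (intro subset_antisym subsetI)
      fix X assume "X \<in> {X \<in> frames25. colspace X \<in> colspace ` U}"
      then obtain Y where "X \<in> frames25" "Y \<in> U" "colspace X = colspace Y" by auto
      moreover from this U obtain A where "invertible A" "Y = X ** A"
        using colspace_eqE[of X Y] by (auto simp: frames25_def)
      ultimately show "X \<in> (\<Union>A\<in>{A :: real^2^2. invertible A}. (\<lambda>X. X ** A) -` U)" by auto
    next
      fix X assume "X \<in> (\<Union>A\<in>{A :: real^2^2. invertible A}. (\<lambda>X. X ** A) -` U)"
      then obtain A where A: "invertible A" "X ** A \<in> U" by auto
      moreover from U A have "X \<in> frames25"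
        using frames25_mult_iff by blast
      ultimately show "X \<in> {X \<in> frames25. colspace X \<in> colspace ` U}"
        using imageI[OF A(2), of colspace] by (simp only: colspace_mult_invertible mem_Collect_eq)
    qed
    moreover have "open ((\<lambda>X. X ** A) -` U)" for A :: "real^2^2"
      using U(1) by (intro open_vimage smooth_on_imp_continuous_on smooth_intros open_UNIV)
    ultimately show "openin Gr25_topology (colspace ` U)"
      using U by (auto simp: openin_Gr25_iff colspace_in_Gr25)
  qed
qed

section \<open>Smooth structures\<close>

text \<open>With the next lemma, products and open pieces of open Euclidean sets keep a single
  identity chart, so smoothness between them reduces to \<open>smooth_on\<close>.\<close>

lemma prod_manifold_euclidean_open:
  "prod_manifold (euclidean_open S) (euclidean_open T) = euclidean_open (S \<times> T)"
  by (simp add: prod_manifold_def euclidean_open_def map_prod.id)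

lemma open_submanifold_euclidean_open:
  "open_submanifold (euclidean_open S) T = euclidean_open (S \<inter> T)"
  by (simp add: open_submanifold_def euclidean_open_def subtopology_subtopology)

lemma points_euclidean_open [simp]: "points (euclidean_open S) = S"
  by (simp add: euclidean_open_def)

lemma smooth_manifold_euclidean_open:
  assumes "open S"
  shows "smooth_manifold (euclidean_open S)"
proof -
  have "homeomorphic_map (top_of_set S) (top_of_set S) id" by simp
  moreover have "smooth_on S (id \<circ> inv_into S id)"
    by (rule smooth_on_cong[OF assms smooth_on_id[OF assms]]) (auto simp: inv_into_f_eq)
  ultimately show ?thesis
    using assms
    by (auto simp: smooth_manifold_def euclidean_open_def subtopology_subtopology
        intro: Hausdorff_space_subtopology second_countable_subtopology second_countable_euclidean
          Hausdorff_space_euclidean)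
qed

lemma smooth_map_euclidean_open:
  assumes "open S" "smooth_on S f" "\<And>x. x \<in> S \<Longrightarrow> f x \<in> T"
  shows "smooth_map (euclidean_open S) (euclidean_open T) f"
proof -
  have "smooth_on (S \<inter> f -` T) (f \<circ> inv_into S id)"
    by (rule smooth_on_cong[OF assms(1,2)]) (auto simp: inv_into_f_eq)
  then show ?thesis
    using assms smooth_on_imp_continuous_on[OF assms(2)]
    by (auto simp: smooth_map_def euclidean_open_def)
qed

section \<open>The Lie group GL(2,R)\<close>

lemma open_GL2: "open {A :: real^2^2. invertible A}"
  by (rule open_invertible_preimage) simp

lemma group_GL2: "group GL2"
  by (rule groupI)
    (auto simp: GL2_def invertible_mult invertible_mat_1 matrix_mul_assoc
      intro!: bexI[of _ "matrix_inv _"] invertible_matrix_inv matrix_inv_mult)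

lemma inv_GL2:
  assumes "invertible A"
  shows "inv\<^bsub>GL2\<^esub> A = matrix_inv A"
  using group.inv_equality[OF group_GL2, of "matrix_inv A" A] assms
  by (simp add: GL2_def invertible_matrix_inv matrix_inv_mult)

lemma lie_group_GL2: "lie_group GL2 GL2_manifold"
proof -
  let ?GL = "{A :: real^2^2. invertible A}"
  have "smooth_on (?GL \<times> ?GL) (\<lambda>(g, h). g ** h)"
    unfolding case_prod_beta by (intro smooth_intros open_Times open_GL2)
  then have "smooth_map (euclidean_open (?GL \<times> ?GL)) (euclidean_open ?GL) (\<lambda>(g, h). g ** h)"
    by (intro smooth_map_euclidean_open open_Times open_GL2)
      (auto simp: case_prod_beta invertible_mult)
  moreover have "smooth_on ?GL matrix_inv"
    using smooth_on_matrix_inv[OF open_GL2 smooth_on_id[OF open_GL2]] by simp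
  then have "smooth_on ?GL (\<lambda>g. inv\<^bsub>GL2\<^esub> g)"
    by (rule smooth_on_cong[OF open_GL2]) (auto simp: inv_GL2)
  then have "smooth_map (euclidean_open ?GL) (euclidean_open ?GL) (\<lambda>g. inv\<^bsub>GL2\<^esub> g)"
    by (intro smooth_map_euclidean_open open_GL2) (auto simp: inv_GL2 invertible_matrix_inv)
  ultimately show ?thesis
    using group_GL2 smooth_manifold_euclidean_open[OF open_GL2]
    by (simp add: lie_group_def GL2_manifold_def prod_manifold_euclidean_open) (simp add: GL2_def)
qed

section \<open>Graph charts as homeomorphisms and the smooth atlas of G(2,5)\<close>

lemma continuous_on_graph:
  fixes E :: "real^'k^'n" and F :: "real^'l^'n"
  shows "continuous_on S (\<lambda>M. E + F ** M)"
  by (rule continuous_on_subset[OF smooth_on_imp_continuous_on[of UNIV]])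
    (intro smooth_intros open_UNIV, simp)

context
  fixes E :: "real^2^5" and F :: "real^3^5" and P :: "real^5^2" and Q :: "real^5^3"
  assumes split: "splitting E F P Q"
begin

lemma colspace_mem_chart_domain_iff:
  "X \<in> frames25 \<and> colspace X \<in> Gr25_chart_domain F \<longleftrightarrow> invertible (P ** X)"
  using splitting_transverse_iff[OF split] splitting_frame[OF split] by blast

lemma openin_Gr25_chart_domain: "openin Gr25_topology (Gr25_chart_domain F)"
proof -
  have "open {X :: real^2^5. invertible (P ** X)}"
    by (intro open_invertible_preimage smooth_on_imp_continuous_on smooth_intros open_UNIV)
  then show ?thesis
    unfolding openin_Gr25_iff colspace_mem_chart_domain_iff
    by (auto simp: Gr25_chart_domain_def)
qed

text \<open>Pulled back to frames, the chart is the rational expression Q X (P X)^(-1).\<close>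

lemma continuous_map_Gr25_chart:
  "continuous_map (subtopology Gr25_topology (Gr25_chart_domain F)) euclidean (Gr25_chart E F)"
proof (rule continuous_map_from_Gr25[OF openin_Gr25_chart_domain])
  have op: "open {X :: real^2^5. invertible (P ** X)}"
    by (intro open_invertible_preimage smooth_on_imp_continuous_on smooth_intros open_UNIV)
  have "continuous_on {X :: real^2^5. invertible (P ** X)} (\<lambda>X. Q ** X ** matrix_inv (P ** X))"
    by (intro smooth_on_imp_continuous_on smooth_intros op) simp
  then show "continuous_on {X \<in> frames25. colspace X \<in> Gr25_chart_domain F}
      (\<lambda>X. Gr25_chart E F (colspace X))"
    unfolding colspace_mem_chart_domain_iff
    by (rule continuous_on_eq) (simp add: Gr25_chart_colspace[OF split])
qed

lemma homeomorphic_map_Gr25_chart: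
  "homeomorphic_map (subtopology Gr25_topology (Gr25_chart_domain F)) euclidean (Gr25_chart E F)"
proof -
  have "continuous_map euclidean Gr25_topology (\<lambda>M. colspace (E + F ** M))"
    using continuous_map_into_Gr25[OF continuous_on_graph[of UNIV]] splitting_graph_frame[OF split]
    by auto
  then have "continuous_map euclidean (subtopology Gr25_topology (Gr25_chart_domain F))
      (\<lambda>M. colspace (E + F ** M))"
    by (auto simp: continuous_map_in_subtopology colspace_graph_mem[OF split])
  then have "homeomorphic_maps (subtopology Gr25_topology (Gr25_chart_domain F)) euclidean
      (Gr25_chart E F) (\<lambda>M. colspace (E + F ** M))"
    using continuous_map_Gr25_chart
    by (auto simp: homeomorphic_maps_def Gr25_chart_domain_eq[OF split]
        Gr25_chart_colspace_graph[OF split])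
  then show ?thesis by (auto simp: homeomorphic_map_maps)
qed

end

text \<open>Converse of \<open>splitting_exists\<close>; it lets the atlas be indexed by
  splittings.\<close>

lemma splitting_imp_bij:
  assumes "splitting E F P Q"
  shows "bij (\<lambda>(x, y). E *v x + F *v y)"
proof (rule o_bij[of "\<lambda>w. (P *v w, Q *v w)"])
  show "(\<lambda>w. (P *v w, Q *v w)) \<circ> (\<lambda>(x, y). E *v x + F *v y) = id"
    using assms[unfolded splitting_def]
    by (auto simp: fun_eq_iff matrix_vector_right_distrib matrix_vector_mul_assoc)
  show "(\<lambda>(x, y). E *v x + F *v y) \<circ> (\<lambda>w. (P *v w, Q *v w)) = id"
    using assms[unfolded splitting_def]
    by (auto simp: fun_eq_iff matrix_vector_mul_assoc matrix_vector_mult_add_rdistrib[symmetric])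
qed

lemma Gr25_manifold_charts:
  "charts Gr25_manifold =
    {(Gr25_chart_domain F, Gr25_chart E F) | E F. \<exists>P Q. splitting E F P Q}"
proof -
  have "bij (\<lambda>(x, y). E *v x + F *v y) \<longleftrightarrow> (\<exists>P Q. splitting E F P Q)"
    for E :: "real^2^5" and F :: "real^3^5"
    using splitting_exists splitting_imp_bij by metis
  then show ?thesis by (simp add: Gr25_manifold_def)
qed

lemma Gr25_chartE:
  assumes "c \<in> charts Gr25_manifold"
  obtains E F P Q where "splitting E F P Q" "c = (Gr25_chart_domain F, Gr25_chart E F)"
  using assms by (auto simp: Gr25_manifold_charts)

lemma mtop_Gr25_manifold [simp]: "mtop Gr25_manifold = Gr25_topology"
  by (simp add: Gr25_manifold_def)

lemma chart_at_exists:
  assumes "W \<in> Gr25"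
  obtains E :: "real^2^5" and F P Q where "splitting E F P Q" "W \<in> Gr25_chart_domain F"
proof -
  obtain E where E: "E \<in> frames25" "W = colspace E" using assms by (rule Gr25_frame)
  obtain F :: "real^3^5" where "bij (\<lambda>(x, y). E *v x + F *v y)"
    using complement_exists[where 'l=3, of E] E(1) by (auto simp: frames25_def)
  then obtain P Q where split: "splitting E F P Q" by (rule splitting_exists)
  \<comment> \<open>\<open>W\<close> itself is the first summand, hence the graph of the zero
    map.\<close>
  with colspace_graph_mem[OF split, of 0] E(2) that show thesis by simp
qed

lemma smooth_manifold_Gr25: "smooth_manifold Gr25_manifold"
  unfolding smooth_manifold_def
proof (intro conjI)
  show "(\<Union>(U, \<phi>)\<in>charts Gr25_manifold. U) = points Gr25_manifold"
  proof
    show "(\<Union>(U, \<phi>)\<in>charts Gr25_manifold. U) \<subseteq> points Gr25_manifold"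
      by (auto simp: Gr25_manifold_charts topspace_Gr25_topology Gr25_chart_domain_def)
    show "points Gr25_manifold \<subseteq> (\<Union>(U, \<phi>)\<in>charts Gr25_manifold. U)"
    proof
      fix W assume "W \<in> points Gr25_manifold"
      then have "W \<in> Gr25" by (simp add: topspace_Gr25_topology)
      then obtain E :: "real^2^5" and F P Q where "splitting E F P Q" "W \<in> Gr25_chart_domain F"
        by (rule chart_at_exists)
      moreover from this(1) have "(Gr25_chart_domain F, Gr25_chart E F) \<in> charts Gr25_manifold"
        by (auto simp: Gr25_manifold_charts)
      ultimately show "W \<in> (\<Union>(U, \<phi>)\<in>charts Gr25_manifold. U)" by blast
    qed
  qed
  show "\<forall>(U, \<phi>)\<in>charts Gr25_manifold. openin (mtop Gr25_manifold) U \<and> open (\<phi> ` U) \<and>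
      homeomorphic_map (subtopology (mtop Gr25_manifold) U) (top_of_set (\<phi> ` U)) \<phi>"
    by (auto simp: Gr25_manifold_charts openin_Gr25_chart_domain Gr25_chart_image
        homeomorphic_map_Gr25_chart)
  \<comment> \<open>Transition maps: the plane with coordinate M has the frame E + F M, so its
    coordinate in the second chart is rational in M wherever P' (E + F M) is invertible.\<close>
  have "smooth_on (Gr25_chart E F ` (Gr25_chart_domain F \<inter> Gr25_chart_domain F'))
      (Gr25_chart E' F' \<circ> inv_into (Gr25_chart_domain F) (Gr25_chart E F))"
    if s: "splitting E F P Q" and s': "splitting E' F' P' Q'" for E F P Q E' F' P' Q'
  proof (rule smooth_on_cong)
    let ?T = "{M. invertible (P' ** (E + F ** M))}"
    show op: "open ?T"
      by (intro open_invertible_preimage smooth_on_imp_continuous_on smooth_intros open_UNIV)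
    show "smooth_on ?T (\<lambda>M. Q' ** (E + F ** M) ** matrix_inv (P' ** (E + F ** M)))"
      by (intro smooth_intros op) simp
    show "Gr25_chart E F ` (Gr25_chart_domain F \<inter> Gr25_chart_domain F') \<subseteq> ?T"
    proof
      fix M assume "M \<in> Gr25_chart E F ` (Gr25_chart_domain F \<inter> Gr25_chart_domain F')"
      then have "colspace (E + F ** M) \<in> Gr25_chart_domain F'"
        unfolding Gr25_chart_domain_eq[OF s] by (auto simp only: Gr25_chart_colspace_graph[OF s] Int_iff)
      then show "M \<in> ?T"
        using splitting_transverse_iff[OF s' splitting_graph_frame[OF s]] by simp
    qed
  qed (simp add: inv_into_Gr25_chart[OF s] Gr25_chart_colspace[OF s'])
  note transition = this
  show "\<forall>(U, \<phi>)\<in>charts Gr25_manifold. \<forall>(V, \<psi>)\<in>charts Gr25_manifold.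
      smooth_on (\<phi> ` (U \<inter> V)) (\<psi> \<circ> inv_into U \<phi>)"
  proof (intro ballI)
    fix c assume "c \<in> charts Gr25_manifold"
    then obtain E F P Q where c: "splitting E F P Q" "c = (Gr25_chart_domain F, Gr25_chart E F)"
      by (rule Gr25_chartE)
    show "case c of (U, \<phi>) \<Rightarrow> \<forall>(V, \<psi>)\<in>charts Gr25_manifold.
        smooth_on (\<phi> ` (U \<inter> V)) (\<psi> \<circ> inv_into U \<phi>)"
      unfolding c(2) prod.case
    proof (intro ballI)
      fix c' assume "c' \<in> charts Gr25_manifold"
      then obtain E' F' P' Q' where c': "splitting E' F' P' Q'"
          "c' = (Gr25_chart_domain F', Gr25_chart E' F')"
        by (rule Gr25_chartE)
      show "case c' of (V, \<psi>) \<Rightarrow>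
          smooth_on (Gr25_chart E F ` (Gr25_chart_domain F \<inter> V))
            (\<psi> \<circ> inv_into (Gr25_chart_domain F) (Gr25_chart E F))"
        unfolding c'(2) prod.case by (rule transition[OF c(1) c'(1)])
    qed
  qed
qed (simp_all add: Hausdorff_Gr25 second_countable_Gr25)

section \<open>The cotangent space and its frames\<close>

definition frame_of :: "real \<Rightarrow> real \<Rightarrow> (real^5) \<times> (real^5) \<Rightarrow> real^2^5"
  where "frame_of lam \<alpha> z =
    (\<chi> i j. if j = 1 then fst z $ i else (matrix_inv (\<eta> lam \<alpha>) *v snd z) $ i)"

definition of_frame :: "real \<Rightarrow> real \<Rightarrow> real^2^5 \<Rightarrow> (real^5) \<times> (real^5)"
  where "of_frame lam \<alpha> Y = (column 1 Y, \<eta> lam \<alpha> *v column 2 Y)"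

lemma frame_of_mult:
  "frame_of lam \<alpha> z *v v = v $ 1 *\<^sub>R fst z + v $ 2 *\<^sub>R (matrix_inv (\<eta> lam \<alpha>) *v snd z)"
  by (simp add: vec_eq_iff frame_of_def matrix_vector_mult_def[of "\<chi> i. _ i"] sum_2 mult.commute)

lemma proj_span_eq_colspace: "proj_span lam \<alpha> z = colspace (frame_of lam \<alpha> z)"
proof -
  have "span {q, r} = range (\<lambda>v :: real^2. v $ 1 *\<^sub>R q + v $ 2 *\<^sub>R r)" for q r :: "real^5"
  proof -
    have comb: "a *\<^sub>R q + b *\<^sub>R r \<in> range (\<lambda>v :: real^2. v $ 1 *\<^sub>R q + v $ 2 *\<^sub>R r)" for a b
      by (rule range_eqI[of _ _ "vector [a, b]"]) simp
    have span: "x \<in> span {q, r} \<longleftrightarrow> (\<exists>a b. x = a *\<^sub>R q + b *\<^sub>R r)" for x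
      by (auto simp: span_breakdown_eq algebra_simps)
    show ?thesis
    proof (intro subset_antisym subsetI)
      fix x assume "x \<in> span {q, r}"
      then show "x \<in> range (\<lambda>v :: real^2. v $ 1 *\<^sub>R q + v $ 2 *\<^sub>R r)"
        unfolding span using comb by (elim exE) simp
    next
      fix x assume "x \<in> range (\<lambda>v :: real^2. v $ 1 *\<^sub>R q + v $ 2 *\<^sub>R r)"
      then show "x \<in> span {q, r}" unfolding span by (elim rangeE) (intro exI)
    qed
  qed
  then show ?thesis by (simp add: proj_span_def case_prod_beta frame_of_mult)
qed

lemma Treg_iff_frame: "z \<in> Treg lam \<alpha> \<longleftrightarrow> frame_of lam \<alpha> z \<in> frames25"
proof -
  have "q \<noteq> r \<and> independent {q, r} \<longleftrightarrow>
      (\<forall>v :: real^2. v $ 1 *\<^sub>R q + v $ 2 *\<^sub>R r = 0 \<longrightarrow> v = 0)" (is "?L \<longleftrightarrow> ?R") for q r :: "real^5"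
  proof
    assume L: ?L
    show ?R
    proof (intro allI impI)
      fix v :: "real^2" assume v: "v $ 1 *\<^sub>R q + v $ 2 *\<^sub>R r = 0"
      have rq: "q \<noteq> r" "r \<noteq> q" "independent {q, r}" using L by auto
      \<comment> \<open>The coefficients become a function on the set {q, r}, which can give r its
        own coefficient because q and r differ.\<close>
      define u where "u x = (if x = q then v $ 1 else v $ 2)" for x
      have sum: "(\<Sum>x\<in>{q, r}. u x *\<^sub>R x) = 0"
        using v rq by (simp add: u_def)
      have "u q = 0" "u r = 0"
        by (rule independentD[OF rq(3) _ _ sum]; simp)+
      then have "v $ 1 = 0" "v $ 2 = 0" using rq by (simp_all add: u_def)
      then show "v = 0" by (simp add: vec_eq_iff forall_2)
    qed
  next
    assume R: ?R
    have R': "a = 0 \<and> b = 0" if "a *\<^sub>R q + b *\<^sub>R r = 0" for a b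
      using R[rule_format, of "vector [a, b]"] that by (simp add: vec_eq_iff forall_2)
    \<comment> \<open>The coefficient pairs (1, -1), (0, 1) and (1, -k) exclude q = r, r = 0 and q =
      k r in turn.\<close>
    have "q \<noteq> r" using R'[of 1 "-1"] by auto
    moreover have "r \<noteq> 0" using R'[of 0 1] by auto
    moreover have "q \<notin> span {r}" using R'[of 1 "- k" for k] by (auto simp: span_singleton)
    ultimately show ?L by (simp add: independent_insert)
  qed
  then show ?thesis
    by (simp add: Treg_def case_prod_beta frames25_def inj_matrix_mult_iff_ker frame_of_mult)
qed

text \<open>The entries of the momentum matrix are the 2 x 2 minors of the frame, and they all
  vanish exactly when its two columns are dependent.\<close>

lemma momentum_J_eq_0_iff:
  "momentum_J lam \<alpha> z = 0 \<longleftrightarrow> z \<notin> Treg lam \<alpha>"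
proof -
  define q r where "q = fst z" and "r = matrix_inv (\<eta> lam \<alpha>) *v snd z"
  have J: "momentum_J lam \<alpha> z = 0 \<longleftrightarrow> (\<forall>i j. q $ i * r $ j = r $ i * q $ j)"
    by (simp add: momentum_J_def case_prod_beta Let_def q_def r_def vec_eq_iff
        matrix_matrix_mult_def columnvector_def rowvector_def)
  have T: "z \<in> Treg lam \<alpha> \<longleftrightarrow> (\<forall>v :: real^2. v $ 1 *\<^sub>R q + v $ 2 *\<^sub>R r = 0 \<longrightarrow> v = 0)"
    by (simp add: Treg_iff_frame frames25_def inj_matrix_mult_iff_ker frame_of_mult q_def r_def)
  show ?thesis
  proof
    assume "momentum_J lam \<alpha> z = 0"
    then have qr: "q $ i * r $ j = r $ i * q $ j" for i j using J by blast
    show "z \<notin> Treg lam \<alpha>"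
    proof (cases "q = 0")
      case True
      then have "(vector [1, 0] :: real^2) $ 1 *\<^sub>R q + (vector [1, 0] :: real^2) $ 2 *\<^sub>R r = 0"
        by simp
      moreover have "(vector [1, 0] :: real^2) \<noteq> 0" by (simp add: vec_eq_iff forall_2)
      ultimately show ?thesis unfolding T by blast
    next
      case False
      then obtain i where i: "q $ i \<noteq> 0" by (auto simp: vec_eq_iff)
      \<comment> \<open>Vanishing of the minors that involve row i says precisely that this vector
        is in the kernel; it is non-zero because q_i is.\<close>
      let ?v = "vector [r $ i, - q $ i] :: real^2"
      have "?v $ 1 *\<^sub>R q + ?v $ 2 *\<^sub>R r = 0"
        using qr[of i] by (simp add: vec_eq_iff)
      moreover have "?v \<noteq> 0" using i by (simp add: vec_eq_iff forall_2)
      ultimately show ?thesis unfolding T by blast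
    qed
  next
    assume "z \<notin> Treg lam \<alpha>"
    then obtain v :: "real^2" where v: "v $ 1 *\<^sub>R q + v $ 2 *\<^sub>R r = 0" "v \<noteq> 0"
      unfolding T by blast
    have vi: "v $ 1 * q $ i + v $ 2 * r $ i = 0" for i
      using arg_cong[OF v(1), of "\<lambda>x. x $ i"] by simp
    have "q $ i * r $ j = r $ i * q $ j" for i j
    proof (cases "v $ 1 = 0")
      case True
      with v(2) have "v $ 2 \<noteq> 0" by (simp add: vec_eq_iff forall_2)
      with True vi[of i] vi[of j] show ?thesis by simp
    next
      case False
      \<comment> \<open>The relation of row i times r_j minus that of row j times r_i eliminates the
        second coefficient.\<close>
      have "v $ 1 * (q $ i * r $ j - r $ i * q $ j) =
          (v $ 1 * q $ i + v $ 2 * r $ i) * r $ j - (v $ 1 * q $ j + v $ 2 * r $ j) * r $ i"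
        by (simp add: algebra_simps)
      then show ?thesis using False by (simp add: vi)
    qed
    then show "momentum_J lam \<alpha> z = 0" using J by blast
  qed
qed

lemma smooth_on_frame_of [smooth_intros]:
  assumes "open S" "smooth_on S f"
  shows "smooth_on S (\<lambda>x. frame_of lam \<alpha> (f x))"
proof -
  have "smooth_on S (\<lambda>x. if j = 1 then fst (f x) $ i
      else (matrix_inv (\<eta> lam \<alpha>) *v snd (f x)) $ i)" for i :: 5 and j :: 2
    by (cases "j = 1") (use assms in \<open>simp_all add: smooth_on_nth smooth_intros\<close>)
  then show ?thesis
    unfolding frame_of_def by (intro smooth_on_vec_lambda assms(1))
qed

lemma smooth_on_of_frame [smooth_intros]:
  assumes "open S" "smooth_on S f"
  shows "smooth_on S (\<lambda>x. of_frame lam \<alpha> (f x))"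
  unfolding of_frame_def column_def
  by (intro smooth_intros smooth_on_vec_lambda smooth_on_nth assms)

lemma open_Treg: "open (Treg lam \<alpha>)"
proof -
  have "Treg lam \<alpha> = frame_of lam \<alpha> -` frames25"
    using Treg_iff_frame by blast
  moreover have "continuous_on UNIV (frame_of lam \<alpha>)"
    using smooth_on_imp_continuous_on[OF smooth_on_frame_of[OF open_UNIV smooth_on_id[OF open_UNIV]]] .
  ultimately show ?thesis by (simp add: open_vimage open_frames25)
qed

section \<open>The action of GL(2,R) expressed through frames\<close>

lemma smooth_on_cotangent_action:
  assumes "open S" "smooth_on S f" "smooth_on S g"
  shows "smooth_on S (\<lambda>x. \<Psi> lam \<alpha> (f x) (g x))"
  unfolding \<Psi>_def case_prod_beta
  by (intro smooth_intros smooth_on_bilinear[OF _ bounded_bilinear_scaleR] smooth_on_nth assms)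

context
  fixes lam \<alpha> :: real
  assumes nz: "\<alpha> * lam \<noteq> 0"
begin

text \<open>The hypothesis enters here: the determinant is the product of the diagonal entries, and
  both \<open>\<alpha> * lam\<close> and \<open>lam\<close> are non-zero.\<close>

lemma eta_inverse:
  "\<eta> lam \<alpha> *v (matrix_inv (\<eta> lam \<alpha>) *v v) = v"
  "matrix_inv (\<eta> lam \<alpha>) *v (\<eta> lam \<alpha> *v v) = v"
proof -
  have "det (\<eta> lam \<alpha>) = (\<Prod>i\<in>UNIV. \<eta> lam \<alpha> $ i $ i)"
    by (rule det_diagonal) (simp add: \<eta>_def)
  also have "\<dots> \<noteq> 0" using nz by (auto simp: \<eta>_def)
  finally have "invertible (\<eta> lam \<alpha>)" by (simp add: invertible_det_nz)
  then show "\<eta> lam \<alpha> *v (matrix_inv (\<eta> lam \<alpha>) *v v) = v"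
    "matrix_inv (\<eta> lam \<alpha>) *v (\<eta> lam \<alpha> *v v) = v"
    by (simp_all add: matrix_vector_mul_assoc matrix_inv_mult)
qed

lemma of_frame_frame_of: "of_frame lam \<alpha> (frame_of lam \<alpha> z) = z"
proof -
  have "column 1 (frame_of lam \<alpha> z) = fst z"
    "column 2 (frame_of lam \<alpha> z) = matrix_inv (\<eta> lam \<alpha>) *v snd z"
    by (simp_all add: vec_eq_iff column_def frame_of_def)
  then show ?thesis by (simp add: of_frame_def eta_inverse)
qed

lemma frame_of_of_frame: "frame_of lam \<alpha> (of_frame lam \<alpha> Y) = Y"
  by (simp add: of_frame_def frame_of_def eta_inverse) (simp add: vec_eq_iff forall_2 column_def[of 1] eta_inverse, simp add: column_def)

text \<open>The rows of \<open>A\<close> hold the coefficients of the new columns, hence the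
  transpose. As transposition reverses products, this right multiplication is a left action.\<close>

lemma frame_of_action: "frame_of lam \<alpha> (\<Psi> lam \<alpha> A z) = frame_of lam \<alpha> z ** transpose A"
proof -
  have "matrix_inv (\<eta> lam \<alpha>) *v snd (\<Psi> lam \<alpha> A z) =
      A $ 2 $ 1 *\<^sub>R fst z + A $ 2 $ 2 *\<^sub>R (matrix_inv (\<eta> lam \<alpha>) *v snd z)"
    by (simp add: \<Psi>_def case_prod_beta matrix_vector_right_distrib matrix_vector_mult_scaleR eta_inverse)
  then show ?thesis
    by (simp add: frame_of_def[of _ _ "\<Psi> lam \<alpha> A z"])
      (simp add: frame_of_def \<Psi>_def case_prod_beta vec_eq_iff forall_2 sum_2
        matrix_matrix_mult_def transpose_def mult.commute)
qed

text \<open>Reduces identities between points of the cotangent space to matrix identities.\<close>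

lemma frame_of_inject: "frame_of lam \<alpha> z = frame_of lam \<alpha> w \<longleftrightarrow> z = w"
  by (metis of_frame_frame_of)

lemma smooth_action_Treg:
  "smooth_action GL2 GL2_manifold (euclidean_open (Treg lam \<alpha>)) (\<Psi> lam \<alpha>)"
proof -
  let ?T = "Treg lam \<alpha>"
  have mem: "\<Psi> lam \<alpha> A z \<in> ?T" if "invertible A" "z \<in> ?T" for A z
    using that by (simp add: Treg_iff_frame frame_of_action frames25_mult_iff invertible_transpose_iff)
  have comp: "\<Psi> lam \<alpha> (A ** B) z = \<Psi> lam \<alpha> A (\<Psi> lam \<alpha> B z)" for A B z
    by (simp add: frame_of_inject[symmetric] frame_of_action matrix_transpose_mul matrix_mul_assoc)
  have one: "\<Psi> lam \<alpha> (mat 1) z = z" for z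
    by (simp add: frame_of_inject[symmetric] frame_of_action)
  have Bij: "restrict (\<Psi> lam \<alpha> A) ?T \<in> Bij ?T" if A: "invertible A" for A
  proof -
    have "bij_betw (\<Psi> lam \<alpha> A) ?T ?T"
      by (rule bij_betw_byWitness[where f' = "\<Psi> lam \<alpha> (matrix_inv A)"])
        (auto simp: comp[symmetric] matrix_inv_mult A one mem invertible_matrix_inv)
    then show ?thesis by (simp add: Bij_def)
  qed
  have "group_action GL2 ?T (\<lambda>g. restrict (\<Psi> lam \<alpha> g) ?T)"
    unfolding group_action_def group_hom_def group_hom_axioms_def
  proof (intro conjI group_GL2 group_BijGroup homI)
    fix A B assume "A \<in> carrier GL2" "B \<in> carrier GL2"
    then have "invertible A" "invertible B" by (simp_all add: GL2_def)
    then show "restrict (\<Psi> lam \<alpha> (A \<otimes>\<^bsub>GL2\<^esub> B)) ?T =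
        restrict (\<Psi> lam \<alpha> A) ?T \<otimes>\<^bsub>BijGroup ?T\<^esub> restrict (\<Psi> lam \<alpha> B) ?T"
      by (auto simp: BijGroup_def Bij compose_def GL2_def fun_eq_iff comp mem)
  qed (simp add: BijGroup_def GL2_def Bij)
  moreover have "smooth_on ({A. invertible A} \<times> ?T) (\<lambda>(A, z). \<Psi> lam \<alpha> A z)"
    unfolding case_prod_beta
    by (intro smooth_on_cotangent_action smooth_intros open_Times open_GL2 open_Treg)
  then have "smooth_map (euclidean_open ({A. invertible A} \<times> ?T)) (euclidean_open ?T)
      (\<lambda>(A, z). \<Psi> lam \<alpha> A z)"
    by (rule smooth_map_euclidean_open[OF open_Times[OF open_GL2 open_Treg]]) (auto simp: mem)
  ultimately show ?thesis
    by (simp add: smooth_action_def GL2_manifold_def prod_manifold_euclidean_open)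
qed

end

text \<open>Regularity and transversality merge into one open condition, which describes the total
  space over a chart domain.\<close>

lemma proj_span_mem_chart_domain_iff:
  fixes E :: "real^2^5" and F :: "real^3^5"
  assumes "splitting E F P Q"
  shows "z \<in> Treg lam \<alpha> \<and> proj_span lam \<alpha> z \<in> Gr25_chart_domain F \<longleftrightarrow>
    invertible (P ** frame_of lam \<alpha> z)"
  by (simp add: Treg_iff_frame proj_span_eq_colspace colspace_mem_chart_domain_iff[OF assms])

lemma continuous_map_proj_span:
  "continuous_map (top_of_set (Treg lam \<alpha>)) Gr25_topology (proj_span lam \<alpha>)"
  unfolding proj_span_eq_colspace
  by (rule continuous_map_into_Gr25)
    (auto simp: Treg_iff_frame intro!: smooth_on_imp_continuous_on smooth_intros open_Treg)

lemma open_transverse: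
  fixes P :: "real^5^2"
  shows "open {z. invertible (P ** frame_of lam \<alpha> z)}"
  by (intro open_invertible_preimage smooth_on_imp_continuous_on smooth_intros open_UNIV)

lemma smooth_map_proj_span:
  "smooth_map (euclidean_open (Treg lam \<alpha>)) Gr25_manifold (proj_span lam \<alpha>)"
proof -
  have "smooth_on (id ` (Treg lam \<alpha> \<inter> proj_span lam \<alpha> -` Gr25_chart_domain F))
      (Gr25_chart E F \<circ> proj_span lam \<alpha> \<circ> inv_into (Treg lam \<alpha>) id)"
    if s: "splitting E F P Q" for E F P Q
  proof (rule smooth_on_cong)
    let ?X = "frame_of lam \<alpha>"
    let ?T = "{z. invertible (P ** ?X z)}"
    show "open ?T" by (rule open_transverse)
    \<comment> \<open>The source has only the identity chart, so the local expression of the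
      projection is the graph coordinate of the frame.\<close>
    then show "smooth_on ?T (\<lambda>z. Q ** ?X z ** matrix_inv (P ** ?X z))"
      by (intro smooth_intros) simp_all
    show "id ` (Treg lam \<alpha> \<inter> proj_span lam \<alpha> -` Gr25_chart_domain F) \<subseteq> ?T"
      using proj_span_mem_chart_domain_iff[OF s] by auto
    fix z assume z: "z \<in> ?T"
    then have "z \<in> Treg lam \<alpha>" using proj_span_mem_chart_domain_iff[OF s] by blast
    then have "inv_into (Treg lam \<alpha>) id z = z" by (simp add: inv_into_f_eq)
    with z show "(Gr25_chart E F \<circ> proj_span lam \<alpha> \<circ> inv_into (Treg lam \<alpha>) id) z =
        Q ** ?X z ** matrix_inv (P ** ?X z)"
      by (simp add: proj_span_eq_colspace Gr25_chart_colspace[OF s])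
  qed
  note charted = this
  have "case c of (U, \<phi>) \<Rightarrow> smooth_on (id ` (Treg lam \<alpha> \<inter> proj_span lam \<alpha> -` U))
      (\<phi> \<circ> proj_span lam \<alpha> \<circ> inv_into (Treg lam \<alpha>) id)" if c: "c \<in> charts Gr25_manifold" for c
  proof -
    obtain E F P Q where EF: "splitting E F P Q" "c = (Gr25_chart_domain F, Gr25_chart E F)"
      using c by (rule Gr25_chartE)
    show ?thesis unfolding EF(2) prod.case by (rule charted[OF EF(1)])
  qed
  then show ?thesis
    using continuous_map_proj_span by (simp add: smooth_map_def euclidean_open_def)
qed

section \<open>Local trivializations\<close>

abbreviation trivial_bundle_over :: "real^3^5 \<Rightarrow> ((real^5) set \<times> (real^2^2), (real^2^3) \<times> (real^2^2)) manifold"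
  where "trivial_bundle_over F \<equiv>
    prod_manifold (open_submanifold Gr25_manifold (Gr25_chart_domain F)) GL2_manifold"

lemma charts_trivial_bundle_overE:
  assumes "c \<in> charts (trivial_bundle_over F)"
  obtains E' F' P' Q' where "splitting E' F' P' Q'"
    "c = ((Gr25_chart_domain F' \<inter> Gr25_chart_domain F) \<times> {A. invertible A},
      map_prod (Gr25_chart E' F') id)"
  using assms
  by (auto simp: prod_manifold_def open_submanifold_def GL2_manifold_def euclidean_open_def
      elim!: Gr25_chartE)

lemma mtop_trivial_bundle_over:
  "mtop (trivial_bundle_over F) =
    prod_topology (subtopology Gr25_topology (Gr25_chart_domain F)) (top_of_set {A. invertible A})"
  by (simp add: prod_manifold_def open_submanifold_def GL2_manifold_def euclidean_open_def)

lemma points_trivial_bundle_over: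
  "points (trivial_bundle_over F) = Gr25_chart_domain F \<times> {A. invertible A}"
  unfolding mtop_trivial_bundle_over
  by (auto simp: topspace_Gr25_topology Gr25_chart_domain_def)

text \<open>Transposing P X A^T gives A (P X)^T, so the group component transforms by left
  translation, as \<open>principal_bundle\<close> requires.\<close>

definition trivialization ::
    "real \<Rightarrow> real \<Rightarrow> real^5^2 \<Rightarrow> (real^5) \<times> (real^5) \<Rightarrow> (real^5) set \<times> (real^2^2)"
  where "trivialization lam \<alpha> P z =
    (proj_span lam \<alpha> z, transpose (P ** frame_of lam \<alpha> z))"

text \<open>The normalized frame of \<open>W\<close> has \<open>P\<close>-component 1; multiplying
  it by g^T on the right gives the frame of \<open>W\<close> with \<open>P\<close>-component
  g^T.\<close>

definition trivialization_inv ::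
    "real \<Rightarrow> real \<Rightarrow> real^2^5 \<Rightarrow> real^3^5 \<Rightarrow> (real^5) set \<times> (real^2^2) \<Rightarrow> (real^5) \<times> (real^5)"
  where "trivialization_inv lam \<alpha> E F =
    (\<lambda>(W, g). of_frame lam \<alpha> ((E + F ** Gr25_chart E F W) ** transpose g))"

context
  fixes lam \<alpha> :: real and E :: "real^2^5" and F :: "real^3^5" and P :: "real^5^2" and Q :: "real^5^3"
  assumes nz: "\<alpha> * lam \<noteq> 0" and split: "splitting E F P Q"
begin

private abbreviation "\<Phi> \<equiv> trivialization lam \<alpha> P"
private abbreviation "\<Theta> \<equiv> trivialization_inv lam \<alpha> E F"
private abbreviation "X \<equiv> frame_of lam \<alpha>"
private abbreviation "D \<equiv> Gr25_chart_domain F"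
private abbreviation "B \<equiv> trivial_bundle_over F"
private abbreviation "GL \<equiv> {A :: real^2^2. invertible A}"
private abbreviation "S \<equiv> {z. invertible (P ** X z)}"

lemma trivialization_mem: "z \<in> S \<Longrightarrow> \<Phi> z \<in> D \<times> GL"
  using proj_span_mem_chart_domain_iff[OF split, of z lam \<alpha>]
  by (simp add: trivialization_def invertible_transpose_iff)

lemma frame_of_trivialization_inv:
  "X (\<Theta> (W, g)) = (E + F ** Gr25_chart E F W) ** transpose g"
  by (simp add: trivialization_inv_def frame_of_of_frame[OF nz])

lemma trivialization_inv_mem: "y \<in> D \<times> GL \<Longrightarrow> \<Theta> y \<in> S"
  by (auto simp: frame_of_trivialization_inv matrix_mul_assoc splitting_graph[OF split]
      invertible_transpose_iff)

lemma trivialization_inv_trivialization: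
  assumes "z \<in> S"
  shows "\<Theta> (\<Phi> z) = z"
proof -
  have inv: "invertible (P ** X z)" using assms by simp
  \<comment> \<open>Passing to the chart normalizes the frame, and the group component multiplies
    the lost factor \<open>P ** X z\<close> back on.\<close>
  have "X (\<Theta> (\<Phi> z)) = X z ** matrix_inv (P ** X z) ** (P ** X z)"
    using inv
    by (simp add: trivialization_def frame_of_trivialization_inv proj_span_eq_colspace
        Gr25_chart_colspace[OF split] splitting_normalize[OF split])
  also have "\<dots> = X z"
    by (simp only: matrix_mul_assoc[symmetric] matrix_inv_mult[OF inv] matrix_mul_rid)
  finally show ?thesis by (simp add: frame_of_inject[OF nz])
qed

lemma trivialization_trivialization_inv:
  assumes "y \<in> D \<times> GL"
  shows "\<Phi> (\<Theta> y) = y"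
proof -
  obtain M g where y: "y = (colspace (E + F ** M), g)" "invertible g"
    using assms by (auto simp: Gr25_chart_domain_eq[OF split])
  then have X: "X (\<Theta> y) = (E + F ** M) ** transpose g"
    by (simp add: frame_of_trivialization_inv Gr25_chart_colspace_graph[OF split])
  show ?thesis
    using y by (simp add: trivialization_def X[unfolded y(1)] proj_span_eq_colspace colspace_mult_invertible
        invertible_transpose_iff matrix_mul_assoc splitting_graph[OF split])
qed

lemma bij_betw_trivialization: "bij_betw \<Phi> S (D \<times> GL)"
  by (rule bij_betw_byWitness[where f' = \<Theta>])
    (use trivialization_mem trivialization_inv_mem trivialization_inv_trivialization
      trivialization_trivialization_inv in blast)+

text \<open>\<open>diffeomorphism\<close> is phrased with \<open>inv_into\<close>; this gives access
  to the explicit inverse.\<close>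

lemma inv_into_trivialization:
  assumes "y \<in> D \<times> GL"
  shows "inv_into S \<Phi> y = \<Theta> y"
  by (rule inv_into_f_eq)
    (use assms bij_betw_trivialization trivialization_inv_mem trivialization_trivialization_inv
      in \<open>auto simp only: bij_betw_def\<close>)

lemma trivialization_equivariant:
  "\<Phi> (\<Psi> lam \<alpha> A z) = (colspace (X z ** transpose A), A ** snd (\<Phi> z))"
  by (simp add: trivialization_def proj_span_eq_colspace frame_of_action[OF nz] matrix_transpose_mul
      matrix_mul_assoc)

lemma smooth_map_trivialization: "smooth_map (euclidean_open S) B \<Phi>"
  unfolding smooth_map_def
proof (intro conjI)
  have sub: "S \<subseteq> Treg lam \<alpha>"
    using proj_span_mem_chart_domain_iff[OF split] by blast
  have "continuous_map (top_of_set S) (subtopology Gr25_topology D) (fst \<circ> \<Phi>)"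
    using continuous_map_from_subtopology_mono[OF continuous_map_proj_span sub]
      trivialization_mem
    by (auto simp: continuous_map_in_subtopology trivialization_def o_def)
  moreover have "continuous_on S (\<lambda>z. transpose (P ** X z))"
    by (intro smooth_on_imp_continuous_on smooth_intros open_transverse)
  then have "continuous_map (top_of_set S) (top_of_set GL) (snd \<circ> \<Phi>)"
    by (auto simp: trivialization_def o_def invertible_transpose_iff)
  ultimately show "continuous_map (mtop (euclidean_open S)) (mtop B) \<Phi>"
    by (simp add: mtop_trivial_bundle_over continuous_map_pairwise euclidean_open_def)
  have "smooth_on (id ` (S \<inter> \<Phi> -` ((Gr25_chart_domain F' \<inter> D) \<times> GL)))
      (map_prod (Gr25_chart E' F') id \<circ> \<Phi> \<circ> inv_into S id)"
    if s: "splitting E' F' P' Q'" for E' F' P' Q'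
  proof (rule smooth_on_cong)
    \<comment> \<open>The frames transverse for both splittings: the fixed one, which trivializes
      the bundle, and the one of the chart on the base.\<close>
    let ?T = "S \<inter> {z. invertible (P' ** X z)}"
    show op: "open ?T" by (intro open_Int open_transverse)
    show "smooth_on ?T (\<lambda>z. (Q' ** X z ** matrix_inv (P' ** X z), transpose (P ** X z)))"
      by (intro smooth_intros op) simp
    show "id ` (S \<inter> \<Phi> -` ((Gr25_chart_domain F' \<inter> D) \<times> GL)) \<subseteq> ?T"
    proof
      fix z assume "z \<in> id ` (S \<inter> \<Phi> -` ((Gr25_chart_domain F' \<inter> D) \<times> GL))"
      then have "z \<in> S" "proj_span lam \<alpha> z \<in> Gr25_chart_domain F'"
        by (auto simp: trivialization_def)
      then show "z \<in> ?T" using proj_span_mem_chart_domain_iff[OF s] sub by blast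
    qed
    fix z assume z: "z \<in> ?T"
    then have "inv_into S id z = z" by (simp add: inv_into_f_eq)
    with z show "(map_prod (Gr25_chart E' F') id \<circ> \<Phi> \<circ> inv_into S id) z =
        (Q' ** X z ** matrix_inv (P' ** X z), transpose (P ** X z))"
      by (simp add: trivialization_def proj_span_eq_colspace Gr25_chart_colspace[OF s])
  qed
  note charted = this
  have "case c of (V, \<psi>) \<Rightarrow> smooth_on (id ` (S \<inter> \<Phi> -` V))
      (\<psi> \<circ> \<Phi> \<circ> inv_into S id)" if c: "c \<in> charts B" for c
  proof (rule charts_trivial_bundle_overE[OF c])
    fix E' F' P' Q'
    assume s: "splitting E' F' P' Q'"
      and c: "c = ((Gr25_chart_domain F' \<inter> D) \<times> GL, map_prod (Gr25_chart E' F') id)"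
    show ?thesis unfolding c prod.case by (rule charted[OF s])
  qed
  then show "\<forall>(U, \<phi>)\<in>charts (euclidean_open S). \<forall>(V, \<psi>)\<in>charts B.
      smooth_on (\<phi> ` (U \<inter> \<Phi> -` V)) (\<psi> \<circ> \<Phi> \<circ> inv_into U \<phi>)"
    by (simp add: euclidean_open_def)
qed

lemma smooth_map_inv_trivialization:
  "smooth_map B (euclidean_open S) (inv_into S \<Phi>)"
  unfolding smooth_map_def
proof (intro conjI)
  \<comment> \<open>For continuity, the inverse is factored as a smooth map of Euclidean spaces
    after the graph chart on the base component.\<close>
  let ?h = "\<lambda>y. of_frame lam \<alpha> ((E + F ** fst y) ** transpose (snd y))"
  have h: "\<Theta> = ?h \<circ> (\<lambda>y. (Gr25_chart E F (fst y), snd y))"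
    by (simp add: fun_eq_iff trivialization_inv_def)
  have "continuous_map (mtop B) euclidean (\<lambda>y. Gr25_chart E F (fst y))"
    using continuous_map_compose[OF continuous_map_fst continuous_map_Gr25_chart[OF split]]
    unfolding mtop_trivial_bundle_over o_def .
  moreover have "continuous_map (mtop B) euclidean snd"
    using continuous_map_snd[of "subtopology Gr25_topology D" "top_of_set GL"]
    unfolding mtop_trivial_bundle_over by (simp add: continuous_map_in_subtopology)
  ultimately have "continuous_map (mtop B) (prod_topology euclidean euclidean)
      (\<lambda>y. (Gr25_chart E F (fst y), snd y))"
    by (simp only: continuous_map_pairwise o_def fst_conv snd_conv)
  then have "continuous_map (mtop B) euclidean (\<lambda>y. (Gr25_chart E F (fst y), snd y))"
    unfolding prod_topology_euclidean .
  moreover have "continuous_on UNIV ?h"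
    by (intro smooth_on_imp_continuous_on smooth_intros open_UNIV)
  then have "continuous_map euclidean euclidean ?h" by simp
  ultimately have "continuous_map (mtop B) euclidean \<Theta>"
    unfolding h by (rule continuous_map_compose)
  then have "continuous_map (mtop B) (top_of_set S) \<Theta>"
    using trivialization_inv_mem points_trivial_bundle_over
    by (auto simp: continuous_map_in_subtopology)
  then show "continuous_map (mtop B) (mtop (euclidean_open S)) (inv_into S \<Phi>)"
    unfolding euclidean_open_def manifold.simps
    by (rule continuous_map_eq) (simp only: points_trivial_bundle_over inv_into_trivialization)
  have "smooth_on (map_prod (Gr25_chart E' F') id `
        (((Gr25_chart_domain F' \<inter> D) \<times> GL) \<inter> inv_into S \<Phi> -` S))
      (id \<circ> inv_into S \<Phi> \<circ>
        inv_into ((Gr25_chart_domain F' \<inter> D) \<times> GL) (map_prod (Gr25_chart E' F') id))"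
    (is "smooth_on (?\<psi> ` (?V \<inter> _)) _")
    if s: "splitting E' F' P' Q'" for E' F' P' Q'
  proof (rule smooth_on_cong)
    \<comment> \<open>A plane given in the chart of (E', F') has this frame; its coordinate for the
      fixed splitting is then Q Y (P Y)^(-1), which is fed into the explicit inverse.\<close>
    let ?Y = "\<lambda>y. E' + F' ** fst y"
    let ?T = "{y. invertible (P ** ?Y y)} \<inter> UNIV \<times> GL"
    show op: "open ?T"
      by (intro open_Int open_Times open_UNIV open_GL2 open_invertible_preimage
          smooth_on_imp_continuous_on smooth_intros)
    show "smooth_on ?T (\<lambda>y. of_frame lam \<alpha>
        ((E + F ** (Q ** ?Y y ** matrix_inv (P ** ?Y y))) ** transpose (snd y)))"
      by (intro smooth_intros op) simp
    show "?\<psi> ` (?V \<inter> inv_into S \<Phi> -` S) \<subseteq> ?T"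
    proof
      fix y assume "y \<in> ?\<psi> ` (?V \<inter> inv_into S \<Phi> -` S)"
      then obtain M where "colspace (E' + F' ** M) \<in> D" "fst y = M" "invertible (snd y)"
        unfolding Gr25_chart_domain_eq[OF s] by (auto simp only: Gr25_chart_colspace_graph[OF s]
            map_prod_simp fst_conv snd_conv Int_iff mem_Times_iff id_apply mem_Collect_eq)
      then show "y \<in> ?T"
        using splitting_transverse_iff[OF split splitting_graph_frame[OF s]]
        by (simp add: mem_Times_iff)
    qed
    fix y assume "y \<in> ?T"
    then have y: "invertible (P ** ?Y y)" "invertible (snd y)" by auto
    \<comment> \<open>The plane lies in both chart domains: in the primed one as a graph, in the
      fixed one because P Y is invertible.\<close>
    have V: "(colspace (?Y y), snd y) \<in> ?V"
      using y colspace_graph_mem[OF s, of "fst y"] splitting_graph_frame[OF s, of "fst y"]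
        splitting_transverse_iff[OF split] by auto
    have "inj_on ?\<psi> ?V"
      by (rule inj_onI)
        (auto simp: Gr25_chart_domain_eq[OF s] Gr25_chart_colspace_graph[OF s])
    then have "inv_into ?V ?\<psi> y = (colspace (?Y y), snd y)"
      using V by (rule inv_into_f_eq) (simp add: Gr25_chart_colspace_graph[OF s])
    moreover have "inv_into S \<Phi> (colspace (?Y y), snd y) =
        \<Theta> (colspace (?Y y), snd y)"
      using V by (intro inv_into_trivialization) auto
    ultimately show "(id \<circ> inv_into S \<Phi> \<circ> inv_into ?V ?\<psi>) y = of_frame lam \<alpha>
        ((E + F ** (Q ** ?Y y ** matrix_inv (P ** ?Y y))) ** transpose (snd y))"
      by (simp add: trivialization_inv_def Gr25_chart_colspace[OF split y(1)])
  qed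
  note charted = this
  have "case c of (V, \<psi>) \<Rightarrow> smooth_on (\<psi> ` (V \<inter> inv_into S \<Phi> -` S))
      (id \<circ> inv_into S \<Phi> \<circ> inv_into V \<psi>)" if c: "c \<in> charts B" for c
  proof (rule charts_trivial_bundle_overE[OF c])
    fix E' F' P' Q'
    assume s: "splitting E' F' P' Q'"
      and c: "c = ((Gr25_chart_domain F' \<inter> D) \<times> GL, map_prod (Gr25_chart E' F') id)"
    show ?thesis unfolding c prod.case by (rule charted[OF s])
  qed
  then show "\<forall>(U, \<phi>)\<in>charts B. \<forall>(V, \<psi>)\<in>charts (euclidean_open S).
      smooth_on (\<phi> ` (U \<inter> inv_into S \<Phi> -` V))
        (\<psi> \<circ> inv_into S \<Phi> \<circ> inv_into U \<phi>)"
    by (simp add: euclidean_open_def)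
qed

lemma diffeomorphism_trivialization: "diffeomorphism (euclidean_open S) B \<Phi>"
  using bij_betw_trivialization smooth_map_trivialization smooth_map_inv_trivialization
  unfolding diffeomorphism_def points_trivial_bundle_over points_euclidean_open by blast

end

section \<open>Assembly of the principal bundle\<close>

theorem mainTheorem3:
  fixes \<alpha> lam :: real
  assumes "\<alpha> * lam \<noteq> 0"
  shows "Treg lam \<alpha> = UNIV - momentum_J lam \<alpha> -` {0} \<and>
    principal_bundle GL2 GL2_manifold (euclidean_open (Treg lam \<alpha>)) Gr25_manifold
      (\<Psi> lam \<alpha>) (proj_span lam \<alpha>)"
proof
  show "Treg lam \<alpha> = UNIV - momentum_J lam \<alpha> -` {0}"
    by (auto simp: momentum_J_eq_0_iff)
  have "\<exists>U \<Phi>. openin (mtop Gr25_manifold) U \<and> W \<in> U \<and>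
      diffeomorphism (open_submanifold (euclidean_open (Treg lam \<alpha>))
          {p \<in> points (euclidean_open (Treg lam \<alpha>)). proj_span lam \<alpha> p \<in> U})
        (prod_manifold (open_submanifold Gr25_manifold U) GL2_manifold) \<Phi> \<and>
      (\<forall>p\<in>points (euclidean_open (Treg lam \<alpha>)). proj_span lam \<alpha> p \<in> U \<longrightarrow>
         fst (\<Phi> p) = proj_span lam \<alpha> p \<and>
         (\<forall>g\<in>carrier GL2. \<Phi> (\<Psi> lam \<alpha> g p) = (proj_span lam \<alpha> p, g \<otimes>\<^bsub>GL2\<^esub> snd (\<Phi> p))))"
    if W: "W \<in> points Gr25_manifold" for W
  proof -
    have "W \<in> Gr25" using W by (simp add: topspace_Gr25_topology)
    then obtain E :: "real^2^5" and F P Q where s: "splitting E F P Q" "W \<in> Gr25_chart_domain F"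
      by (rule chart_at_exists)
    let ?\<Phi> = "trivialization lam \<alpha> P"
    let ?T = "Treg lam \<alpha>" and ?D = "Gr25_chart_domain F"
    \<comment> \<open>The total space over the chart domain is exactly the open set on which the
      trivialization was shown to be a diffeomorphism.\<close>
    have eq: "?T \<inter> {p \<in> ?T. proj_span lam \<alpha> p \<in> ?D} = {z. invertible (P ** frame_of lam \<alpha> z)}"
      using proj_span_mem_chart_domain_iff[OF s(1)] by blast
    have "diffeomorphism (open_submanifold (euclidean_open ?T) {p \<in> ?T. proj_span lam \<alpha> p \<in> ?D})
        (prod_manifold (open_submanifold Gr25_manifold ?D) GL2_manifold) ?\<Phi>"
      unfolding open_submanifold_euclidean_open eq
      by (rule diffeomorphism_trivialization[OF assms s(1)])
    \<comment> \<open>For invertible g the column space of X g^T is that of X, so the base component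
      is unchanged.\<close>
    moreover have "?\<Phi> (\<Psi> lam \<alpha> g p) = (proj_span lam \<alpha> p, g ** snd (?\<Phi> p))"
      if "invertible g" for g p
      using that
      by (simp add: trivialization_equivariant[OF assms s(1)] proj_span_eq_colspace
          colspace_mult_invertible invertible_transpose_iff)
    ultimately show ?thesis
      using openin_Gr25_chart_domain[OF s(1)] s(2)
      by (intro exI[of _ ?D] exI[of _ ?\<Phi>])
        (simp add: GL2_def trivialization_def)
  qed
  then show "principal_bundle GL2 GL2_manifold (euclidean_open (Treg lam \<alpha>)) Gr25_manifold
      (\<Psi> lam \<alpha>) (proj_span lam \<alpha>)"
    unfolding principal_bundle_def
    using lie_group_GL2 smooth_manifold_euclidean_open[OF open_Treg] smooth_manifold_Gr25
      smooth_action_Treg[OF assms] smooth_map_proj_span by blast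
qed

end
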